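(* Suppose that every round is single-crossing with respect to the same given voter order. There is a polynomial-time online rule that, at every horizon, satisfies all-rank-wPJR with additive loss $2\lceil\log_2 n\rceil$. No deterministic online rule can replace this additive loss by $o(\log n)$ for all such profiles. The lower bound holds on static strict one-dimensional Euclidean profiles with $m=n$. Thus, the optimal worst-case additive loss for all-rank-wPJR on this domain (for online rules) is $\Theta(\log n)$.
   Context: Model. Voters $V=[n]$, a set $C$ of $m$ candidates, rounds $T=\{1,\dots,|T|\}$ with $n,m,|T|\ge1$; $|T|$ is the horizon. In each round $j$ each voter $i$ has a strict complete ranking of $C$; a profile consists of all rankings and is static if they are the same in all rounds. For $r\in[m]$, $A_i^j(r)$ is the set of voter $i$'s $r$ most-preferred candidates in round $j$. A sequence is $W=(w^1,\dots,w^{|T|})\in C^{|T|}$. A group is a nonempty $S\subseteq V$. A rule is online if each $w^j$ depends only on the rankings in rounds $1,\dots,j$ (and the given voter order) and not on $|T|$. Domains. Rankings in a round are single-crossing with respect to a linear order of $V$ if, for every pair of candidates $a,b$, the voters preferring $a$ to $b$ form a prefix or a suffix of that order. A profile is strict one-dimensional Euclidean if, in each round, voters and candidates can be placed on the real line so that every voter ranks candidates by increasing distance from her position, with no ties in distance (such rankings are single-crossing with respect to the order of the voters on the line). All-rank-wPJR with additive loss $L$ (an integer $L\ge0$): for every rank matrix $R=(r_i^j)\in[m]^{|T|\times n}$, every group $S$ such that $\bigcap_{i\in S}A_i^j(r_i^j)\ne\varnothing$ for all $j\in T$ has at least $\lfloor|T||S|/n\rfloor-L$ rounds $j$ with $w^j\in\bigcup_{i\in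 S}A_i^j(r_i^j)$. The optimal worst-case additive loss, as a function of $n$, is the smallest $L(n)$ such that some deterministic online rule satisfies all-rank-wPJR with additive loss $L(n)$ on every $n$-voter profile of the domain at every horizon; asymptotics are as $n\to\infty$. *)

theory Defs
  imports
    Complex_Main
    "HOL-Library.Landau_Symbols"
    "HOL-Computational_Algebra.Polynomial"
begin

(* Voters are 0, ..., n - 1, candidates are 0, ..., m - 1, and rounds are list positions, so the
   horizon of P is length P. In P ! j ! i, the ranking of voter i in round j, the most preferred
   candidate comes first. *)
type_synonym ranking = "nat list"
type_synonym ballots = "ranking list"
type_synonym profile = "ballots list"

(* A voter order is the list of all voters in that order. *)
type_synonym voter_order = "nat list"

definition is_ranking :: "nat \<Rightarrow> ranking \<Rightarrow> bool" where
  "is_ranking m r \<longleftrightarrow> distinct r \<and> set r = {..<m}"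

definition is_voter_order :: "nat \<Rightarrow> voter_order \<Rightarrow> bool" where
  "is_voter_order n \<sigma> \<longleftrightarrow> distinct \<sigma> \<and> set \<sigma> = {..<n}"

definition is_profile :: "nat \<Rightarrow> nat \<Rightarrow> profile \<Rightarrow> bool" where
  "is_profile n m P \<longleftrightarrow>
     n \<ge> 1 \<and> m \<ge> 1 \<and> length P \<ge> 1 \<and>
     (\<forall>B\<in>set P. length B = n \<and> (\<forall>r\<in>set B. is_ranking m r))"

definition prefers :: "ranking \<Rightarrow> nat \<Rightarrow> nat \<Rightarrow> bool" where
  "prefers r a b \<longleftrightarrow> (\<exists>k l. k < l \<and> l < length r \<and> r ! k = a \<and> r ! l = b)"

definition top_set :: "profile \<Rightarrow> nat \<Rightarrow> nat \<Rightarrow> nat \<Rightarrow> nat set" where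
  "top_set P j i r = set (take r (P ! j ! i))"

definition static :: "profile \<Rightarrow> bool" where
  "static P \<longleftrightarrow> (\<forall>j<length P. \<forall>k<length P. P ! j = P ! k)"


definition single_crossing_round :: "nat \<Rightarrow> nat \<Rightarrow> voter_order \<Rightarrow> ballots \<Rightarrow> bool" where
  "single_crossing_round n m \<sigma> B \<longleftrightarrow>
     (\<forall>a<m. \<forall>b<m. \<exists>k\<le>n.
        {i. i < n \<and> prefers (B ! i) a b} = set (take k \<sigma>) \<or>
        {i. i < n \<and> prefers (B ! i) a b} = set (drop k \<sigma>))"

(* The strict comparison in sorted_wrt also rules out ties in distance. *)
definition euclidean_round :: "nat \<Rightarrow> ballots \<Rightarrow> bool" where
  "euclidean_round n B \<longleftrightarrow>
     (\<exists>(x :: nat \<Rightarrow> real) (y :: nat \<Rightarrow> real). \<forall>i<n.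
        sorted_wrt (\<lambda>a b. \<bar>x i - y a\<bar> < \<bar>x i - y b\<bar>) (B ! i))"

type_synonym domain = "nat \<Rightarrow> nat \<Rightarrow> voter_order \<Rightarrow> profile \<Rightarrow> bool"

definition single_crossing :: domain where
  "single_crossing n m \<sigma> P \<longleftrightarrow> (\<forall>B\<in>set P. single_crossing_round n m \<sigma> B)"

definition static_euclidean :: domain where
  "static_euclidean n m \<sigma> P \<longleftrightarrow>
     single_crossing n m \<sigma> P \<and> static P \<and> (\<forall>B\<in>set P. euclidean_round n B) \<and> m = n"


definition all_rank_wPJR :: "nat \<Rightarrow> nat \<Rightarrow> profile \<Rightarrow> (nat \<Rightarrow> nat) \<Rightarrow> nat \<Rightarrow> bool" where
  "all_rank_wPJR n m P w L \<longleftrightarrow>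
     (\<forall>R :: nat \<Rightarrow> nat \<Rightarrow> nat. \<forall>S.
        (\<forall>j<length P. \<forall>i<n. R j i \<in> {1..m}) \<and>
        S \<noteq> {} \<and> S \<subseteq> {..<n} \<and>
        (\<forall>j<length P. (\<Inter>i\<in>S. top_set P j i (R j i)) \<noteq> {}) \<longrightarrow>
        int (card {j. j < length P \<and> w j \<in> (\<Union>i\<in>S. top_set P j i (R j i))})
          \<ge> \<lfloor>real (length P) * real (card S) / real n\<rfloor> - int L)"


(* An online rule computes the winner of a round from the voter order and the list of all
   ballots up to and including this round. It sees n and m through the lengths of these lists,
   but it does not see the horizon. *)
type_synonym rule = "voter_order \<Rightarrow> profile \<Rightarrow> nat"

definition online_rule :: "rule \<Rightarrow> bool" where
  "online_rule f \<longleftrightarrow>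
     (\<forall>n m \<sigma> P. is_voter_order n \<sigma> \<and> is_profile n m P \<longrightarrow> f \<sigma> P < m)"

definition outcome :: "rule \<Rightarrow> voter_order \<Rightarrow> profile \<Rightarrow> nat \<Rightarrow> nat" where
  "outcome f \<sigma> P j = f \<sigma> (take (Suc j) P)"

definition attains_loss :: "domain \<Rightarrow> nat \<Rightarrow> rule \<Rightarrow> nat \<Rightarrow> bool" where
  "attains_loss D n f L \<longleftrightarrow>
     (\<forall>m \<sigma> P. is_voter_order n \<sigma> \<and> is_profile n m P \<and> D n m \<sigma> P \<longrightarrow>
        all_rank_wPJR n m P (outcome f \<sigma> P) L)"

definition optimal_loss :: "domain \<Rightarrow> nat \<Rightarrow> nat" where
  "optimal_loss D n = (LEAST L. \<exists>f. online_rule f \<and> attains_loss D n f L)"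


(* Polynomial time refers to structured programs for a random access machine with registers and
   an indirectly addressed memory of natural numbers, whose arithmetic is addition and truncated
   subtraction. Each executed assignment, skip and test costs one step. Since there is no
   multiplication, a fixed program increases the bit length of the largest number occurring in
   the computation by at most a constant per step, so unit cost and Turing machine time
   are polynomially related. *)
datatype aexp = Lit nat | Reg nat | Mem aexp | Add aexp aexp | Sub aexp aexp

datatype bexp = Less aexp aexp | Eq aexp aexp

datatype com =
    Skip
  | SetReg nat aexp
  | SetMem aexp aexp
  | Seq com com
  | If bexp com com
  | While bexp com

type_synonym state = "(nat \<Rightarrow> nat) \<times> (nat \<Rightarrow> nat)"  (* registers, memory *)

fun aval :: "aexp \<Rightarrow> state \<Rightarrow> nat" where
  "aval (Lit k) s = k"
| "aval (Reg x) s = fst s x"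
| "aval (Mem a) s = snd s (aval a s)"
| "aval (Add a b) s = aval a s + aval b s"
| "aval (Sub a b) s = aval a s - aval b s"

fun bval :: "bexp \<Rightarrow> state \<Rightarrow> bool" where
  "bval (Less a b) s \<longleftrightarrow> aval a s < aval b s"
| "bval (Eq a b) s \<longleftrightarrow> aval a s = aval b s"

(* exec c s t s': started in s, the program c terminates in s' after exactly t steps. *)
inductive exec :: "com \<Rightarrow> state \<Rightarrow> nat \<Rightarrow> state \<Rightarrow> bool" where
  Skip: "exec Skip s 1 s"
| SetReg: "exec (SetReg x a) s 1 ((fst s)(x := aval a s), snd s)"
| SetMem: "exec (SetMem a b) s 1 (fst s, (snd s)(aval a s := aval b s))"
| Seq: "exec c s t s' \<Longrightarrow> exec d s' t' s'' \<Longrightarrow> exec (Seq c d) s (t + t') s''"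
| IfTrue: "bval b s \<Longrightarrow> exec c s t s' \<Longrightarrow> exec (If b c d) s (1 + t) s'"
| IfFalse: "\<not> bval b s \<Longrightarrow> exec d s t s' \<Longrightarrow> exec (If b c d) s (1 + t) s'"
| WhileFalse: "\<not> bval b s \<Longrightarrow> exec (While b c) s 1 s"
| WhileTrue: "bval b s \<Longrightarrow> exec c s t s' \<Longrightarrow> exec (While b c) s' t' s'' \<Longrightarrow>
    exec (While b c) s (1 + t + t') s''"

(* The input consists of n, m, the number of rounds so far, the voter order, and the
   rankings written one after another, round by round and voter by voter. Every entry is at most
   the length of this list, which therefore measures the input size up to a logarithmic factor. *)
definition encode :: "voter_order \<Rightarrow> profile \<Rightarrow> nat list" where
  "encode \<sigma> P = [length \<sigma>, length (P ! 0 ! 0), length P] @ \<sigma> @ concat (concat P)"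

definition init_state :: "nat list \<Rightarrow> state" where
  "init_state xs = ((\<lambda>_. 0), (\<lambda>k. if k < length xs then xs ! k else 0))"

(* The output is left in register 0. *)
definition polytime_rule :: "rule \<Rightarrow> bool" where
  "polytime_rule f \<longleftrightarrow>
     (\<exists>(c :: com) (q :: nat poly). \<forall>n m \<sigma> P. is_voter_order n \<sigma> \<and> is_profile n m P \<longrightarrow>
        (\<exists>t s. exec c (init_state (encode \<sigma> P)) t s \<and> fst s 0 = f \<sigma> P \<and>
               t \<le> poly q (length (encode \<sigma> P))))"

end

(*
  Upper bound. By single crossing, the favourite of a voter v represents every coherent group with
  members on both sides of v (v included), so it suffices to pick voters in an order in which every
  interval of voters receives its share of the rounds up to a logarithmic error. Split the voters
  recursively into halves and let each left half receive the rounded-down share of the visits of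
  its parent: every prefix then deviates by less than one per level, always downwards.

  Lower bound. Put voter i and candidate i at the same point 2^i. A group of voters that is a prefix
  or a suffix is then only represented by its own candidates, so additive loss L forces the infinite
  sequence of winners to have discrepancy at most L + 1 on all prefixes at all times. Schmidt's
  theorem excludes this: average over the thresholds k the oscillation in time of the discrepancy of
  [0, k). Over a time window of length 4l it is at least the mean of the oscillations over the first
  and last quarter plus the distance between their midpoints. Most intervals [k, k + e) with e of
  order n / l receive no winner during the window, so the discrepancies of [0, k) and [0, k + e)
  drift apart linearly and the midpoints of at least one of them move by a constant. Each
  quadrupling of the window thus adds a constant.
*)
theory Submission
  imports Defs "HOL-Real_Asymp.Real_Asymp"
begin

section \<open>A voter sequence of low prefix discrepancy\<close>

lemma card_less_Suc:
  "card {j. j < Suc T \<and> Q j} = card {j. j < T \<and> Q j} + of_bool (Q T)"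
proof -
  have "{j. j < Suc T \<and> Q j} = {j. j < T \<and> Q j} \<union> (if Q T then {T} else {})"
    by (auto simp: less_Suc_eq)
  then show ?thesis by auto
qed

text \<open>The \<open>N\<close>-th visit (counted from 0) of a binary tree with \<open>p\<close> leaves: the left half receives
  \<open>\<lfloor>N a / p\<rfloor>\<close> of the first \<open>N\<close> visits, where \<open>a\<close> is its size.\<close>
function pick :: "nat \<Rightarrow> nat \<Rightarrow> nat" where
  "pick p N =
     (if p \<le> 1 then 0
      else let a = p div 2; q = N * a div p in
        if N * a mod p + a < p then a + pick (p - a) (N - q) else pick a q)"
  by pat_completeness auto
termination by (relation "measure fst") auto

declare pick.simps [simp del]

lemma pick_less: "p \<ge> 1 \<Longrightarrow> pick p N < p"
proof (induction p N rule: pick.induct)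
  case (1 p N)
  show ?case
  proof (cases "p \<le> 1")
    case True
    then show ?thesis using 1 by (simp add: pick.simps)
  next
    case False
    define a where "a = p div 2"
    define q where "q = N * a div p"
    have a: "a \<ge> 1" "a < p" using False by (auto simp: a_def)
    show ?thesis
    proof (cases "N * a mod p + a < p")
      case True
      then have "pick (p - a) (N - q) < p - a"
        using 1(1)[OF False a_def q_def] a by simp
      moreover have "pick p N = a + pick (p - a) (N - q)"
        using True False by (simp add: pick.simps[of p] Let_def a_def q_def)
      ultimately show ?thesis using a by linarith
    next
      case F: False
      then have "pick a q < a" using 1(2)[OF False a_def q_def] a by simp
      moreover have "pick p N = pick a q"
        using F False by (simp add: pick.simps[of p] Let_def a_def q_def)
      ultimately show ?thesis using a by linarith
    qed
  qed
qed

text \<open>Since \<open>a \<le> p\<close>, one more summand \<open>a\<close> crosses at most one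
  multiple of \<open>p\<close>, and does so exactly when the remainder plus \<open>a\<close> reaches
  \<open>p\<close>. This is the test in \<open>pick\<close>, so \<open>T * a div p\<close> is the
  number of left visits among the first \<open>T\<close>.\<close>

lemma Suc_mult_div:
  fixes a p :: nat
  assumes "a \<le> p" "0 < p"
  shows "Suc T * a div p = T * a div p + of_bool (p \<le> T * a mod p + a)"
proof -
  define q r where "q = T * a div p" and "r = T * a mod p"
  have eq: "Suc T * a = q * p + (r + a)" by (simp add: q_def r_def)
  have r: "r < p" using assms by (simp add: r_def)
  have "Suc T * a div p = q + (r + a) div p" using assms unfolding eq by simp
  moreover have "(r + a) div p = of_bool (p \<le> r + a)"
  proof (cases "p \<le> r + a")
    case True
    then have "(r + a) div p = Suc ((r + a - p) div p)" using assms by (simp add: le_div_geq)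
    moreover have "r + a - p < p" using r assms by linarith
    ultimately show ?thesis using True by simp
  next
    case False
    then show ?thesis by simp
  qed
  ultimately show ?thesis by (simp add: q_def r_def)
qed

section \<open>Visits below a threshold\<close>

definition pick_count :: "nat \<Rightarrow> nat \<Rightarrow> nat \<Rightarrow> nat" where
  "pick_count p k T = card {j. j < T \<and> pick p j < k}"

lemma pick_count_Suc: "pick_count p k (Suc T) = pick_count p k T + of_bool (pick p T < k)"
  unfolding pick_count_def by (rule card_less_Suc)

lemma pick_count_0_right [simp]: "pick_count p k 0 = 0"
  by (simp add: pick_count_def)

text \<open>The visits to either half run through that half's own sequence without gaps. A threshold
  up to \<open>a\<close> sees only left visits; a larger one sees all of them and a prefix of the
  right half.\<close>

lemma pick_count_split:
  assumes p: "2 \<le> p" and a: "a = p div 2"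
  shows "pick_count p k T =
    (if k \<le> a then pick_count a k (T * a div p)
     else T * a div p + pick_count (p - a) (k - a) (T - T * a div p))"
proof (induction T)
  case 0
  then show ?case by simp
next
  case (Suc T)
  define q where "q = T * a div p"
  have a': "1 \<le> a" "a \<le> p" "0 < p" using p by (auto simp: a)
  have "q \<le> T * p div p" unfolding q_def using a' by (intro div_le_mono mult_le_mono) auto
  then have q: "q \<le> T" using a' by simp
  have Sq: "Suc T * a div p = q + of_bool (p \<le> T * a mod p + a)"
    unfolding q_def using a' by (intro Suc_mult_div) auto
  show ?case
  proof (cases "p \<le> T * a mod p + a")
    case True
    then have "pick p T = pick a q" using p by (simp add: pick.simps[of p] a q_def Let_def)
    moreover have "pick a q < a" using a' by (intro pick_less)
    ultimately show ?thesis
      unfolding pick_count_Suc Suc Sq using True by (auto simp: pick_count_Suc q_def)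
  next
    case False
    then have "pick p T = a + pick (p - a) (T - q)"
      using p by (simp add: pick.simps[of p] a q_def Let_def)
    moreover have "Suc T - q = Suc (T - q)" using q by simp
    ultimately show ?thesis
      unfolding pick_count_Suc Suc Sq using False
      by (auto simp: pick_count_Suc q_def[symmetric])
  qed
qed

text \<open>Induction on the depth \<open>d\<close>: rounding at the root costs at most 1, the half
  below it at most \<open>d\<close>. The left half is always rounded down, so the upper bound
  carries no error; an interval, as a difference of two prefixes, then loses \<open>d\<close> and
  not \<open>2 * d\<close>.\<close>

lemma pick_count_bounds:
  assumes "1 \<le> p" "p \<le> 2 ^ d" "k \<le> p"
  shows "real T * k / p - d \<le> pick_count p k T" "pick_count p k T \<le> real T * k / p"
  using assms
proof (induction d arbitrary: p k T)
  case 0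
  {
    case 1
    then have "p = 1" "k = 0 \<or> k = 1" by auto
    then show ?case by (auto simp: pick_count_def pick.simps)
  next
    case 2
    then have "p = 1" "k = 0 \<or> k = 1" by auto
    then show ?case by (auto simp: pick_count_def pick.simps)
  }
next
  case (Suc d)
  have *: "real T * k / p - Suc d \<le> pick_count p k T \<and> pick_count p k T \<le> real T * k / p"
    if asm: "1 \<le> p" "p \<le> 2 ^ Suc d" "k \<le> p" for p k T
  proof (cases "p = 1")
    case True
    then have "k = 0 \<or> k = 1" using asm by auto
    then show ?thesis using True by (auto simp: pick_count_def pick.simps)
  next
    case False
    then have p: "2 \<le> p" using asm by simp
    define a where "a = p div 2"
    define b where "b = p - a"
    define q where "q = T * a div p"
    have a: "1 \<le> a" "a \<le> 2 ^ d" "1 \<le> b" "b \<le> 2 ^ d" "p = a + b"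
      using p asm by (auto simp: a_def b_def)
    \<comment> \<open>The exact share of the left half; \<open>q\<close> is its integer
      part.\<close>
    define y where "y = real T * a / p"
    have "y = q + real (T * a mod p) / p"
      unfolding y_def q_def using of_nat_of_nat_div_aux[of "T * a" p, where ?'a = real] by simp
    moreover have "real (T * a mod p) / p \<le> 1"
      using mod_less_divisor[of p "T * a"] a by (simp del: mod_less_divisor)
    ultimately have qle: "real q \<le> y" and qge: "y - q \<le> 1"
      by simp_all
    have "q \<le> T * p div p" unfolding q_def using a by (intro div_le_mono mult_le_mono) auto
    then have qT: "q \<le> T" using a by simp
    show ?thesis
    proof (cases "k \<le> a")
      case True
      then have eq: "pick_count p k T = pick_count a k q"
        using pick_count_split[OF p a_def] by (simp add: q_def)
      \<comment> \<open>The fraction of the left half below the threshold: the target is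
        \<open>y * x\<close>, and rounding replaces it by \<open>q * x\<close>.\<close>
      define x where "x = real k / a"
      have x: "0 \<le> x" "x \<le> 1" using True a by (auto simp: x_def)
      have "real q * x - d \<le> pick_count a k q" "pick_count a k q \<le> real q * x"
        using Suc.IH[of a k q] a True by (auto simp: x_def)
      moreover have "real T * k / p = y * x" using a by (simp add: x_def y_def)
      moreover have "real q * x \<le> y * x" "(y - q) * x \<le> 1"
        using qle qge x by (auto intro: mult_right_mono mult_le_one)
      ultimately show ?thesis unfolding eq by (simp add: algebra_simps)
    next
      case False
      then have eq: "pick_count p k T = q + pick_count b (k - a) (T - q)"
        using pick_count_split[OF p a_def] by (simp add: q_def b_def)
      define x where "x = real (k - a) / b"
      have k: "k - a \<le> b" using asm a by simp
      have x: "0 \<le> x" "x \<le> 1" using k a by (auto simp: x_def)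
      have "real (T - q) * x - d \<le> pick_count b (k - a) (T - q)"
        "pick_count b (k - a) (T - q) \<le> real (T - q) * x"
        using Suc.IH[of b "k - a" "T - q"] a k by (auto simp: x_def)
      then have IH: "(real T - q) * x - d \<le> pick_count b (k - a) (T - q)"
        "pick_count b (k - a) (T - q) \<le> (real T - q) * x"
        using qT by (simp_all add: of_nat_diff)
      have kx: "real k = a + b * x" using False a by (simp add: x_def of_nat_diff)
      have e: "real T * k / p = y + (T - y) * x"
      proof -
        have "T - y = real T * b / p" unfolding y_def using a by (simp add: field_simps)
        then show ?thesis unfolding kx by (simp add: y_def distrib_left add_divide_distrib)
      qed
      \<comment> \<open>This product is the change of the target \<open>y + (T - y) * x\<close> when
        \<open>y\<close> is rounded down to \<open>q\<close>: the right half gains what the left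
        half loses, and a fraction \<open>x\<close> of it still counts.\<close>
      have "(y - q) * (1 - x) \<ge> 0" "(y - q) * (1 - x) \<le> 1"
        using qle qge x by (auto intro: mult_le_one)
      then show ?thesis using IH unfolding eq e by (simp add: algebra_simps)
    qed
  qed
  {
    case 1
    then show ?case using * by blast
  next
    case 2
    then show ?case using * by blast
  }
qed

section \<open>The interleaved favourites rule\<close>

text \<open>The history is one longer than the index of its current round, so
  \<open>length P - 1\<close> is that index and the horizon does not enter.\<close>

definition interleaved_rule :: rule where
  "interleaved_rule \<sigma> P = hd (last P ! (\<sigma> ! pick (length \<sigma>) (length P - 1)))"

lemma is_voter_order_length: "is_voter_order n \<sigma> \<Longrightarrow> length \<sigma> = n"
  unfolding is_voter_order_def by (metis card_lessThan distinct_card)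

lemma is_voter_order_nth: "is_voter_order n \<sigma> \<Longrightarrow> p < n \<Longrightarrow> \<sigma> ! p < n"
  using is_voter_order_length[of n \<sigma>] unfolding is_voter_order_def by (metis lessThan_iff nth_mem)

lemma is_ranking_length: "is_ranking m r \<Longrightarrow> length r = m"
  unfolding is_ranking_def by (metis card_lessThan distinct_card)

lemma is_profile_ranking:
  "is_profile n m P \<Longrightarrow> j < length P \<Longrightarrow> i < n \<Longrightarrow> is_ranking m (P ! j ! i)"
  unfolding is_profile_def by (metis nth_mem)

lemma outcome_interleaved_rule:
  assumes "is_voter_order n \<sigma>" "is_profile n m P" "j < length P"
  shows "outcome interleaved_rule \<sigma> P j = P ! j ! (\<sigma> ! pick n j) ! 0"
proof -
  have n: "1 \<le> n" "1 \<le> m" using assms(2) by (auto simp: is_profile_def)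
  have "\<sigma> ! pick n j < n" using assms n by (intro is_voter_order_nth pick_less)
  then have "length (P ! j ! (\<sigma> ! pick n j)) = m"
    using assms by (metis is_profile_ranking is_ranking_length)
  moreover have "last (take (Suc j) P) = P ! j" using assms(3) by (simp add: take_Suc_conv_app_nth)
  ultimately show ?thesis
    using is_voter_order_length[OF assms(1)] assms(3) n
    unfolding outcome_def interleaved_rule_def by (subst hd_conv_nth) auto
qed

lemma outcome_last: "P \<noteq> [] \<Longrightarrow> f \<sigma> P = outcome f \<sigma> P (length P - 1)"
  by (simp add: outcome_def)

lemma online_interleaved_rule: "online_rule interleaved_rule"
  unfolding online_rule_def
proof (intro allI impI, elim conjE)
  fix n m \<sigma> P assume a: "is_voter_order n \<sigma>" "is_profile n m P"
  define j where "j = length P - 1"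
  have n: "1 \<le> n" "1 \<le> m" "j < length P" "P \<noteq> []" using a by (auto simp: is_profile_def j_def)
  define r where "r = P ! j ! (\<sigma> ! pick n j)"
  have r: "is_ranking m r" unfolding r_def
    using a n by (intro is_profile_ranking[of n] is_voter_order_nth pick_less) auto
  then have "r ! 0 \<in> set r" using is_ranking_length[of m r] n by (intro nth_mem) auto
  then show "interleaved_rule \<sigma> P < m"
    using r outcome_interleaved_rule[OF a n(3)] outcome_last[OF n(4)]
    by (simp add: is_ranking_def r_def j_def)
qed

lemma prefers_of_take:
  assumes "c \<in> set (take k r)" "w \<notin> set (take k r)" "w \<in> set r"
  shows "prefers r c w"
proof -
  obtain a where a: "a < k" "a < length r" "r ! a = c"
    using assms(1) by (auto simp: in_set_conv_nth)
  obtain b where b: "b < length r" "r ! b = w"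
    using assms(3) by (auto simp: in_set_conv_nth)
  then have "\<not> b < k" using assms(2) by (auto simp: in_set_conv_nth)
  then show ?thesis unfolding prefers_def using a b by (intro exI[of _ a] exI[of _ b]) auto
qed

lemma not_prefers_first:
  assumes "distinct r"
  shows "\<not> prefers r c (r ! 0)"
proof
  assume "prefers r c (r ! 0)"
  then obtain k l where "k < l" "l < length r" "r ! l = r ! 0" by (auto simp: prefers_def)
  then show False using assms nth_eq_iff_index_eq[of r l 0] by force
qed

text \<open>Positions are unique in a distinct list, so a prefix containing the entry at
  \<open>hi\<close> contains all entries before it, and a suffix containing the entry at
  \<open>lo\<close> all entries after it.\<close>

lemma prefix_or_suffix_convex:
  assumes "distinct \<sigma>" "X = set (take k \<sigma>) \<or> X = set (drop k \<sigma>)"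
    "\<sigma> ! lo \<in> X" "\<sigma> ! hi \<in> X" "lo \<le> p" "p \<le> hi" "hi < length \<sigma>"
  shows "\<sigma> ! p \<in> X"
proof -
  have idx: "\<sigma> ! i = \<sigma> ! l \<longleftrightarrow> i = l" if "i < length \<sigma>" "l < length \<sigma>" for i l
    using that assms(1) by (simp add: nth_eq_iff_index_eq)
  from assms(2) show ?thesis
  proof
    assume X: "X = set (take k \<sigma>)"
    then obtain l where "l < k" "l < length \<sigma>" "\<sigma> ! l = \<sigma> ! hi"
      using assms(4) by (auto simp: in_set_conv_nth)
    then have "p < k" using idx assms(6,7) by auto
    then have "take k \<sigma> ! p = \<sigma> ! p" "p < length (take k \<sigma>)" using assms(6,7) by auto
    then show ?thesis using X by (metis nth_mem)
  next
    assume X: "X = set (drop k \<sigma>)"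
    then obtain l where "k + l < length \<sigma>" "\<sigma> ! (k + l) = \<sigma> ! lo"
      using assms(3) by (auto simp: in_set_conv_nth less_diff_conv add.commute)
    then have "k \<le> p" using idx assms(5,6,7) by auto
    then have "drop k \<sigma> ! (p - k) = \<sigma> ! p" "p - k < length (drop k \<sigma>)" using assms(6,7) by auto
    then show ?thesis using X by (metis nth_mem)
  qed
qed

text \<open>If all of a group preferred some candidate to the favourite of a voter between two of its
  members, then by single crossing so would that voter.\<close>
lemma favourite_represents:
  assumes ord: "is_voter_order n \<sigma>" and P: "is_profile n m P" "j < length P"
    and sc: "single_crossing_round n m \<sigma> (P ! j)"
    and p: "lo \<le> p" "p \<le> hi" "hi < n"
    and S: "S \<subseteq> {..<n}" "\<sigma> ! lo \<in> S" "\<sigma> ! hi \<in> S"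
    and c: "c \<in> (\<Inter>i\<in>S. top_set P j i (R i))"
  shows "P ! j ! (\<sigma> ! p) ! 0 \<in> (\<Union>i\<in>S. top_set P j i (R i))"
proof (rule ccontr)
  define w where "w = P ! j ! (\<sigma> ! p) ! 0"
  assume "P ! j ! (\<sigma> ! p) ! 0 \<notin> (\<Union>i\<in>S. top_set P j i (R i))"
  then have w: "w \<notin> top_set P j i (R i)" if "i \<in> S" for i using that by (auto simp: w_def)
  have rk: "is_ranking m (P ! j ! i)" if "i < n" for i
    using that P by (intro is_profile_ranking)
  have pn: "\<sigma> ! p < n" using ord p by (intro is_voter_order_nth) auto
  have "m \<ge> 1" using P by (simp add: is_profile_def)
  then have "w \<in> set (P ! j ! (\<sigma> ! p))"
    unfolding w_def using is_ranking_length[OF rk[OF pn]] by (intro nth_mem) auto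
  then have wm: "w < m" using rk[OF pn] by (simp add: is_ranking_def)
  have "c \<in> set (P ! j ! (\<sigma> ! lo))"
    using c S(2) by (meson INT_E in_set_takeD top_set_def[THEN equalityD1] subsetD)
  moreover have "\<sigma> ! lo < n" using S by blast
  ultimately have cm: "c < m" using rk[of "\<sigma> ! lo"] by (simp add: is_ranking_def)
  have pref: "prefers (P ! j ! i) c w" if "i \<in> S" for i
  proof (rule prefers_of_take)
    show "c \<in> set (take (R i) (P ! j ! i))" using INT_D[OF c that] by (simp add: top_set_def)
    show "w \<notin> set (take (R i) (P ! j ! i))" using w[OF that] by (simp add: top_set_def)
    have "is_ranking m (P ! j ! i)" using that S(1) by (intro rk) auto
    then show "w \<in> set (P ! j ! i)" using wm by (simp add: is_ranking_def)
  qed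
  define X where "X = {i. i < n \<and> prefers (P ! j ! i) c w}"
  have SX: "S \<subseteq> X" unfolding X_def using S(1) pref by blast
  obtain k where k: "X = set (take k \<sigma>) \<or> X = set (drop k \<sigma>)"
    using sc[unfolded single_crossing_round_def, rule_format, OF cm wm] X_def by blast
  have "distinct \<sigma>" using ord by (simp add: is_voter_order_def)
  then have "\<sigma> ! p \<in> X"
  proof (rule prefix_or_suffix_convex[OF _ k])
    show "\<sigma> ! lo \<in> X" "\<sigma> ! hi \<in> X" using SX S by blast+
    show "hi < length \<sigma>" using p(3) is_voter_order_length[OF ord] by simp
  qed (use p in simp_all)
  then have "prefers (P ! j ! (\<sigma> ! p)) c w" by (simp add: X_def)
  moreover have "distinct (P ! j ! (\<sigma> ! p))" using rk[OF pn] by (simp add: is_ranking_def)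
  ultimately show False
    using not_prefers_first unfolding w_def by metis
qed

text \<open>Every voter picked between the outermost positions \<open>lo\<close> and
  \<open>hi\<close> of \<open>S\<close> serves the whole group, and there are at least
  \<open>card S\<close> positions in this interval. Its number of rounds is a difference of two
  prefix counts.\<close>

lemma interleaved_rule_attains:
  assumes "n \<le> 2 ^ d"
  shows "attains_loss single_crossing n interleaved_rule d"
  unfolding attains_loss_def all_rank_wPJR_def
proof (intro allI impI, elim conjE)
  fix m \<sigma> P R S
  assume ord: "is_voter_order n \<sigma>" and P: "is_profile n m P" and sc: "single_crossing n m \<sigma> P"
    and S: "S \<noteq> {}" "S \<subseteq> {..<n}"
    and coh: "\<forall>j<length P. (\<Inter>i\<in>S. top_set P j i (R j i)) \<noteq> {}"
  define T where "T = length P"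
  define good where "good = {j. j < T \<and> outcome interleaved_rule \<sigma> P j \<in> (\<Union>i\<in>S. top_set P j i (R j i))}"
  have len: "length \<sigma> = n" using ord by (rule is_voter_order_length)
  define I where "I = {p. p < n \<and> \<sigma> ! p \<in> S}"
  have "S \<subseteq> (!) \<sigma> ` I"
  proof
    fix i assume i: "i \<in> S"
    then have "i \<in> set \<sigma>" using S(2) ord by (auto simp: is_voter_order_def)
    then obtain p where "p < length \<sigma>" "\<sigma> ! p = i" by (auto simp: in_set_conv_nth)
    then show "i \<in> (!) \<sigma> ` I" using i len by (auto simp: I_def)
  qed
  moreover have fin: "finite I" by (simp add: I_def)
  ultimately have "card S \<le> card I" by (rule surj_card_le[rotated])
  moreover have "I \<noteq> {}" using \<open>S \<subseteq> (!) \<sigma> ` I\<close> S(1) by blast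
  ultimately have I: "I \<noteq> {}" "card S \<le> card I" by simp_all
  define lo hi where "lo = Min I" and "hi = Max I"
  have lohi: "lo \<in> I" "hi \<in> I" "I \<subseteq> {lo..hi}" using fin I by (auto simp: lo_def hi_def)
  have "card I \<le> card {lo..hi}" using lohi(3) by (intro card_mono) simp_all
  then have cS: "card S \<le> Suc hi - lo" using I by simp
  have n: "1 \<le> n" "hi < n" "lo \<le> hi" using lohi by (auto simp: I_def)
  have "{j. j < T \<and> pick n j < Suc hi} - {j. j < T \<and> pick n j < lo} \<subseteq> good"
  proof
    fix j assume "j \<in> {j. j < T \<and> pick n j < Suc hi} - {j. j < T \<and> pick n j < lo}"
    then have j: "j < length P" "lo \<le> pick n j" "pick n j \<le> hi" by (auto simp: T_def)
    obtain c where c: "c \<in> (\<Inter>i\<in>S. top_set P j i (R j i))" using coh j by blast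
    have "single_crossing_round n m \<sigma> (P ! j)"
      using sc j(1) by (simp add: single_crossing_def)
    then have "P ! j ! (\<sigma> ! pick n j) ! 0 \<in> (\<Union>i\<in>S. top_set P j i (R j i))"
      using j(2,3) lohi(1,2) S(2) c unfolding I_def mem_Collect_eq
      by (intro favourite_represents[OF ord P j(1)]) (assumption | simp)+
    then show "j \<in> good"
      unfolding good_def T_def outcome_interleaved_rule[OF ord P j(1), symmetric] using j(1) by simp
  qed
  then have le: "card ({j. j < T \<and> pick n j < Suc hi} - {j. j < T \<and> pick n j < lo}) \<le> card good"
    by (intro card_mono) (auto simp: good_def)
  then have "pick_count n (Suc hi) T \<le> card good + pick_count n lo T"
  proof -
    have "pick_count n (Suc hi) T - pick_count n lo T \<le>
        card ({j. j < T \<and> pick n j < Suc hi} - {j. j < T \<and> pick n j < lo})"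
      unfolding pick_count_def by (rule diff_card_le_card_Diff) simp
    then show ?thesis using le by linarith
  qed
  then have "real (pick_count n (Suc hi) T) \<le> card good + real (pick_count n lo T)"
    by (simp flip: of_nat_add)
  \<comment> \<open>Only this prefix is charged the error \<open>d\<close>; the prefix below
    \<open>lo\<close> is subtracted, and its count never exceeds its share.\<close>
  moreover have "real T * Suc hi / n - d \<le> pick_count n (Suc hi) T"
    using n assms by (intro pick_count_bounds) auto
  moreover have "pick_count n lo T \<le> real T * lo / n"
    using n assms by (intro pick_count_bounds[of n d]) auto
  moreover have "real T * card S / n \<le> real T * Suc hi / n - real T * lo / n"
  proof -
    have "real (card S) \<le> real (Suc hi) - real lo" using cS n by linarith
    then have "real T * card S / n \<le> real T * (real (Suc hi) - real lo) / n"
      by (intro divide_right_mono mult_left_mono) auto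
    then show ?thesis by (simp add: right_diff_distrib diff_divide_distrib)
  qed
  ultimately have "real T * card S / n - d \<le> card good" by linarith
  then have "\<lfloor>real T * card S / n\<rfloor> - int d \<le> int (card good)" by linarith
  then show "\<lfloor>real (length P) * real (card S) / real n\<rfloor> - int d \<le>
      int (card {j. j < length P \<and> outcome interleaved_rule \<sigma> P j \<in> (\<Union>i\<in>S. top_set P j i (R j i))})"
    by (simp add: good_def T_def)
qed

section \<open>Running time\<close>

text \<open>Bounds compose by addition, and branches of different cost can share one bound.\<close>

definition exec_le :: "com \<Rightarrow> state \<Rightarrow> nat \<Rightarrow> state \<Rightarrow> bool" where
  "exec_le c s b s' \<longleftrightarrow> (\<exists>t\<le>b. exec c s t s')"

lemma exec_le_mono: "exec_le c s b s' \<Longrightarrow> b \<le> b' \<Longrightarrow> exec_le c s b' s'"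
  unfolding exec_le_def using le_trans by blast

lemma exec_le_Skip: "exec_le Skip s 1 s"
  unfolding exec_le_def using exec.Skip by blast

lemma exec_le_SetReg: "exec_le (SetReg x a) (\<rho>, M) 1 (\<rho>(x := aval a (\<rho>, M)), M)"
  unfolding exec_le_def using exec.SetReg[of x a "(\<rho>, M)"] by auto

text \<open>The new registers can be given in any convenient form; an equation between functions
  remains for the simplifier.\<close>

lemma exec_le_SetReg_eq:
  "\<rho>' = \<rho>(x := aval a (\<rho>, M)) \<Longrightarrow> exec_le (SetReg x a) (\<rho>, M) 1 (\<rho>', M)"
  using exec_le_SetReg by simp

lemma exec_le_Seq:
  "exec_le c s b s' \<Longrightarrow> exec_le d s' b' s'' \<Longrightarrow> exec_le (Seq c d) s (b + b') s''"
  unfolding exec_le_def using exec.Seq add_mono by blast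

lemma exec_le_If:
  assumes "bval b s \<Longrightarrow> exec_le c s k s'" "\<not> bval b s \<Longrightarrow> exec_le d s k s'"
  shows "exec_le (If b c d) s (1 + k) s'"
  using assms exec.IfTrue[of b s c _ s' d] exec.IfFalse[of b s d _ s' c]
  unfolding exec_le_def by (cases "bval b s") (metis add_left_mono)+

lemma exec_le_WhileFalse: "\<not> bval b s \<Longrightarrow> exec_le (While b c) s 1 s"
  unfolding exec_le_def using exec.WhileFalse by blast

lemma exec_le_WhileTrue:
  assumes "bval b s" "exec_le c s k s'" "exec_le (While b c) s' k' s''"
  shows "exec_le (While b c) s (1 + k + k') s''"
proof -
  obtain t t' where "t \<le> k" "exec c s t s'" "t' \<le> k'" "exec (While b c) s' t' s''"
    using assms(2,3) by (auto simp: exec_le_def)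
  then show ?thesis
    unfolding exec_le_def using assms(1)
    by (intro exI[of _ "1 + t + t'"] conjI exec.WhileTrue[of b s c t s']) simp_all
qed

text \<open>The invariant is an explicit trajectory: \<open>f i\<close> is the state after
  \<open>i\<close> passes. Each pass costs its body and one test, and the failing test costs
  1.\<close>

lemma exec_le_loop:
  assumes "\<And>i. i < N \<Longrightarrow> bval b (f i)" "\<And>i. i < N \<Longrightarrow> exec_le c (f i) k (f (Suc i))"
    "\<not> bval b (f N)"
  shows "exec_le (While b c) (f 0) (1 + N * (1 + k)) (f N)"
proof -
  \<comment> \<open>Induction on the number \<open>j\<close> of passes still to come, because a loop
    unfolds at its first pass.\<close>
  have "exec_le (While b c) (f (N - j)) (1 + j * (1 + k)) (f N)" if "j \<le> N" for j
    using that
  proof (induction j)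
    case 0
    then show ?case using exec_le_WhileFalse[OF assms(3)] by simp
  next
    case (Suc j)
    then have "Suc (N - Suc j) = N - j" by simp
    then have "exec_le (While b c) (f (N - Suc j)) (1 + k + (1 + j * (1 + k))) (f N)"
      using Suc assms(1,2)[of "N - Suc j"] by (intro exec_le_WhileTrue[of _ _ _ _ "f (N - j)"]) auto
    then show ?case by (rule exec_le_mono) simp
  qed
  from this[of N] show ?thesis by simp
qed

text \<open>Registers: 1 the size of the current subtree, 2 the index of the visit in it, 3 the leaves to
  its left, 4 the size of its left half, 5 a counter, 6 and 7 quotient and remainder.\<close>
definition halve_prog :: com where
  "halve_prog =
     Seq (SetReg 4 (Lit 0))
    (Seq (SetReg 5 (Reg 1))
      (While (Less (Lit 1) (Reg 5))
        (Seq (SetReg 5 (Sub (Reg 5) (Lit 2)))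
             (SetReg 4 (Add (Reg 4) (Lit 1))))))"

text \<open>Halving by repeated subtraction of 2, which leaves the parity in the counter. The entire
  final register function is given, so that later code can rely on all other registers.\<close>

lemma exec_halve_prog:
  "exec_le halve_prog (\<rho>, M) (3 + 3 * \<rho> 1) (\<rho>(4 := \<rho> 1 div 2, 5 := \<rho> 1 mod 2), M)"
proof -
  define p where "p = \<rho> 1"
  define f where "f i = (\<rho>(4 := i, 5 := p - 2 * i), M)" for i
  have step: "exec_le (Seq (SetReg 5 (Sub (Reg 5) (Lit 2))) (SetReg 4 (Add (Reg 4) (Lit 1))))
      (f i) (1 + 1) (f (Suc i))" for i
    unfolding f_def
    by (rule exec_le_Seq[OF exec_le_SetReg exec_le_SetReg_eq]) (auto simp: fun_eq_iff)
  have "exec_le (While (Less (Lit 1) (Reg 5))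
        (Seq (SetReg 5 (Sub (Reg 5) (Lit 2))) (SetReg 4 (Add (Reg 4) (Lit 1)))))
      (f 0) (1 + p div 2 * (1 + (1 + 1))) (f (p div 2))"
    using step by (intro exec_le_loop) (auto simp: f_def)
  moreover have "f (p div 2) = (\<rho>(4 := p div 2, 5 := p mod 2), M)"
    by (simp add: f_def minus_mult_div_eq_mod)
  moreover have "f 0 = (\<rho>(4 := 0, 5 := p), M)" by (simp add: f_def)
  moreover have "exec_le (SetReg 4 (Lit 0)) (\<rho>, M) 1 (\<rho>(4 := 0), M)"
    using exec_le_SetReg[of 4 "Lit 0"] by simp
  moreover have "exec_le (SetReg 5 (Reg 1)) (\<rho>(4 := 0), M) 1 (\<rho>(4 := 0, 5 := p), M)"
    using exec_le_SetReg[of 5 "Reg 1" "\<rho>(4 := 0)"] by (simp add: p_def)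
  ultimately have "exec_le halve_prog (\<rho>, M) (1 + (1 + (1 + p div 2 * (1 + (1 + 1)))))
      (\<rho>(4 := p div 2, 5 := p mod 2), M)"
    unfolding halve_prog_def by (intro exec_le_Seq) simp_all
  then show ?thesis unfolding p_def by (rule exec_le_mono) simp
qed

text \<open>Quotient and remainder are maintained while \<open>a\<close> is added \<open>N\<close>
  times; the product \<open>N * a\<close> is never formed.\<close>

definition divmod_prog :: com where
  "divmod_prog =
     Seq (SetReg 5 (Reg 2))
    (Seq (SetReg 6 (Lit 0))
    (Seq (SetReg 7 (Lit 0))
      (While (Less (Lit 0) (Reg 5))
        (Seq (SetReg 5 (Sub (Reg 5) (Lit 1)))
        (Seq (SetReg 7 (Add (Reg 7) (Reg 4)))
          (If (Less (Reg 7) (Reg 1)) Skip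
            (Seq (SetReg 7 (Sub (Reg 7) (Reg 1)))
                 (SetReg 6 (Add (Reg 6) (Lit 1))))))))))"

text \<open>Companion of \<open>Suc_mult_div\<close> for the remainder: one carry per summand
  suffices, as \<open>a \<le> p\<close> keeps the sum below \<open>2 * p\<close>.\<close>

lemma Suc_mult_mod:
  fixes a p :: nat
  assumes "a \<le> p" "0 < p"
  shows "Suc T * a mod p = (if T * a mod p + a < p then T * a mod p + a else T * a mod p + a - p)"
proof -
  have "Suc T * a mod p = (T * a mod p + a) mod p"
    using mod_add_left_eq[of "T * a" p a] by (simp add: add.commute)
  moreover have "T * a mod p + a - p < p"
    using mod_less_divisor[OF assms(2), of "T * a"] assms(1) by linarith
  ultimately show ?thesis by (simp add: le_mod_geq)
qed

lemma exec_divmod_prog: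
  assumes "\<rho> 4 \<le> \<rho> 1" "0 < \<rho> 1"
  shows "exec_le divmod_prog (\<rho>, M) (4 + 6 * \<rho> 2)
    (\<rho>(5 := 0, 6 := \<rho> 2 * \<rho> 4 div \<rho> 1, 7 := \<rho> 2 * \<rho> 4 mod \<rho> 1), M)"
proof -
  define p a N where "p = \<rho> 1" and "a = \<rho> 4" and "N = \<rho> 2"
  have ap: "a \<le> p" "0 < p" using assms by (auto simp: p_def a_def)
  \<comment> \<open>Both spellings of register 1 are listed because simplification turns
    \<open>1\<close> into \<open>Suc 0\<close>.\<close>
  have regs: "\<rho> 1 = p" "\<rho> (Suc 0) = p" "\<rho> 4 = a" "\<rho> 2 = N" by (simp_all add: p_def a_def N_def)
  define f where "f i = (\<rho>(5 := N - i, 6 := i * a div p, 7 := i * a mod p), M)" for i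
  have step: "exec_le (Seq (SetReg 5 (Sub (Reg 5) (Lit 1)))
        (Seq (SetReg 7 (Add (Reg 7) (Reg 4)))
          (If (Less (Reg 7) (Reg 1)) Skip
            (Seq (SetReg 7 (Sub (Reg 7) (Reg 1))) (SetReg 6 (Add (Reg 6) (Lit 1)))))))
      (f i) (1 + (1 + (1 + (1 + 1)))) (f (Suc i))" for i
  proof -
    define g where "g = (\<rho>(5 := N - Suc i, 6 := i * a div p, 7 := i * a mod p + a), M)"
    have 1: "exec_le (SetReg 5 (Sub (Reg 5) (Lit 1))) (f i) 1
        (\<rho>(5 := N - Suc i, 6 := i * a div p, 7 := i * a mod p), M)"
      unfolding f_def by (rule exec_le_SetReg_eq) (auto simp: fun_eq_iff)
    have 2: "exec_le (SetReg 7 (Add (Reg 7) (Reg 4)))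
        (\<rho>(5 := N - Suc i, 6 := i * a div p, 7 := i * a mod p), M) 1 g"
      unfolding g_def by (rule exec_le_SetReg_eq) (auto simp: fun_eq_iff regs)
    have 3: "exec_le (If (Less (Reg 7) (Reg 1)) Skip
            (Seq (SetReg 7 (Sub (Reg 7) (Reg 1))) (SetReg 6 (Add (Reg 6) (Lit 1)))))
        g (1 + (1 + 1)) (f (Suc i))"
    proof (rule exec_le_If)
      assume "bval (Less (Reg 7) (Reg 1)) g"
      then have "f (Suc i) = g"
        unfolding f_def g_def Suc_mult_div[OF ap] Suc_mult_mod[OF ap]
        by (auto simp: regs fun_eq_iff)
      then show "exec_le Skip g (1 + 1) (f (Suc i))"
        using exec_le_mono[OF exec_le_Skip] by simp
    next
      assume "\<not> bval (Less (Reg 7) (Reg 1)) g"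
      then have "\<not> i * a mod p + a < p" by (simp add: g_def regs)
      then show "exec_le (Seq (SetReg 7 (Sub (Reg 7) (Reg 1))) (SetReg 6 (Add (Reg 6) (Lit 1))))
          g (1 + 1) (f (Suc i))"
        unfolding f_def g_def Suc_mult_div[OF ap] Suc_mult_mod[OF ap]
        by (intro exec_le_Seq[OF exec_le_SetReg exec_le_SetReg_eq]) (auto simp: fun_eq_iff regs)
    qed
    show ?thesis by (rule exec_le_Seq[OF 1 exec_le_Seq[OF 2 3]])
  qed
  have "exec_le (SetReg 5 (Reg 2)) (\<rho>, M) 1 (\<rho>(5 := N), M)"
    by (rule exec_le_SetReg_eq) (simp add: regs)
  moreover have "exec_le (SetReg 6 (Lit 0)) (\<rho>(5 := N), M) 1 (\<rho>(5 := N, 6 := 0), M)"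
    by (rule exec_le_SetReg_eq) simp
  moreover have "exec_le (SetReg 7 (Lit 0)) (\<rho>(5 := N, 6 := 0), M) 1 (f 0)"
    unfolding f_def by (rule exec_le_SetReg_eq) simp
  moreover have "exec_le (While (Less (Lit 0) (Reg 5))
        (Seq (SetReg 5 (Sub (Reg 5) (Lit 1)))
        (Seq (SetReg 7 (Add (Reg 7) (Reg 4)))
          (If (Less (Reg 7) (Reg 1)) Skip
            (Seq (SetReg 7 (Sub (Reg 7) (Reg 1))) (SetReg 6 (Add (Reg 6) (Lit 1))))))))
      (f 0) (1 + N * (1 + (1 + (1 + (1 + (1 + 1)))))) (f N)"
    by (rule exec_le_loop, simp add: f_def, rule step, simp add: f_def)
  ultimately have "exec_le divmod_prog (\<rho>, M)
      (1 + (1 + (1 + (1 + N * (1 + (1 + (1 + (1 + (1 + 1))))))))) (f N)"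
    unfolding divmod_prog_def by (blast intro: exec_le_Seq)
  moreover have "f N = (\<rho>(5 := 0, 6 := \<rho> 2 * \<rho> 4 div \<rho> 1, 7 := \<rho> 2 * \<rho> 4 mod \<rho> 1), M)"
    by (simp add: f_def regs)
  ultimately show ?thesis by (auto simp: regs elim: exec_le_mono)
qed

definition pick_step :: com where
  "pick_step =
     Seq halve_prog (Seq divmod_prog
      (If (Less (Add (Reg 7) (Reg 4)) (Reg 1))
        (Seq (SetReg 3 (Add (Reg 3) (Reg 4)))
        (Seq (SetReg 1 (Sub (Reg 1) (Reg 4)))
             (SetReg 2 (Sub (Reg 2) (Reg 6)))))
        (Seq (SetReg 1 (Reg 4))
             (SetReg 2 (Reg 6)))))"

text \<open>One level of the recursion of \<open>pick\<close>. Only registers 1 to 3 are specified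
  afterwards, since every pass sets the others anew before reading them.\<close>

lemma exec_pick_step:
  assumes "1 < p" "\<rho> 1 = p" "\<rho> 2 = N" "\<rho> 3 = lo"
  defines "a \<equiv> p div 2" and "q \<equiv> N * (p div 2) div p"
  shows "\<exists>\<rho>'. exec_le pick_step (\<rho>, M) (11 + 3 * p + 6 * N) (\<rho>', M) \<and>
    (if N * a mod p + a < p then \<rho>' 1 = p - a \<and> \<rho>' 2 = N - q \<and> \<rho>' 3 = lo + a
     else \<rho>' 1 = a \<and> \<rho>' 2 = q \<and> \<rho>' 3 = lo)"
proof -
  define \<rho>1 where "\<rho>1 = \<rho>(4 := a, 5 := p mod 2)"
  define \<rho>2 where "\<rho>2 = \<rho>1(5 := 0, 6 := q, 7 := N * a mod p)"
  define c where "c = If (Less (Add (Reg 7) (Reg 4)) (Reg 1))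
        (Seq (SetReg 3 (Add (Reg 3) (Reg 4)))
        (Seq (SetReg 1 (Sub (Reg 1) (Reg 4)))
             (SetReg 2 (Sub (Reg 2) (Reg 6)))))
        (Seq (SetReg 1 (Reg 4))
             (SetReg 2 (Reg 6)))"
  have regs: "\<rho> 1 = p" "\<rho> (Suc 0) = p" "\<rho> 2 = N" "\<rho> 3 = lo" using assms by simp_all
  have r1: "\<rho>1 1 = p" "\<rho>1 2 = N" "\<rho>1 4 = a" by (simp_all add: \<rho>1_def regs)
  have 1: "exec_le halve_prog (\<rho>, M) (3 + 3 * p) (\<rho>1, M)"
    using exec_halve_prog[of \<rho> M] by (simp add: \<rho>1_def regs a_def)
  have 2: "exec_le divmod_prog (\<rho>1, M) (4 + 6 * N) (\<rho>2, M)"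
    using exec_divmod_prog[of \<rho>1 M, unfolded r1] assms(1) by (simp add: \<rho>2_def a_def q_def)
  have r2: "\<rho>2 1 = p" "\<rho>2 (Suc 0) = p" "\<rho>2 2 = N" "\<rho>2 3 = lo" "\<rho>2 4 = a" "\<rho>2 6 = q" "\<rho>2 7 = N * a mod p"
    by (simp_all add: \<rho>2_def \<rho>1_def regs)
  define \<rho>' where "\<rho>' = (if N * a mod p + a < p
      then \<rho>2(3 := lo + a, 1 := p - a, 2 := N - q) else \<rho>2(1 := a, 2 := q))"
  have "exec_le c (\<rho>2, M) (1 + (1 + (1 + 1))) (\<rho>', M)"
    unfolding c_def
  proof (rule exec_le_If)
    assume "bval (Less (Add (Reg 7) (Reg 4)) (Reg 1)) (\<rho>2, M)"
    then show "exec_le (Seq (SetReg 3 (Add (Reg 3) (Reg 4)))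
        (Seq (SetReg 1 (Sub (Reg 1) (Reg 4))) (SetReg 2 (Sub (Reg 2) (Reg 6)))))
        (\<rho>2, M) (1 + (1 + 1)) (\<rho>', M)"
      by (intro exec_le_Seq[OF exec_le_SetReg exec_le_Seq[OF exec_le_SetReg exec_le_SetReg_eq]])
        (simp add: \<rho>'_def r2)
  next
    assume "\<not> bval (Less (Add (Reg 7) (Reg 4)) (Reg 1)) (\<rho>2, M)"
    then have "\<rho>' = \<rho>2(1 := a, 2 := q)" by (simp add: \<rho>'_def r2)
    then have "exec_le (Seq (SetReg 1 (Reg 4)) (SetReg 2 (Reg 6))) (\<rho>2, M) (1 + 1) (\<rho>', M)"
      by (intro exec_le_Seq[OF exec_le_SetReg exec_le_SetReg_eq]) (simp add: r2)
    then show "exec_le (Seq (SetReg 1 (Reg 4)) (SetReg 2 (Reg 6))) (\<rho>2, M) (1 + (1 + 1)) (\<rho>', M)"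
      by (rule exec_le_mono) simp
  qed
  then have "exec_le pick_step (\<rho>, M) (3 + 3 * p + (4 + 6 * N + (1 + (1 + (1 + 1))))) (\<rho>', M)"
    unfolding pick_step_def c_def[symmetric] by (intro exec_le_Seq[OF 1] exec_le_Seq[OF 2])
  then have "exec_le pick_step (\<rho>, M) (11 + 3 * p + 6 * N) (\<rho>', M)" by (rule exec_le_mono) simp
  then show ?thesis by (intro exI[of _ \<rho>']) (simp add: \<rho>'_def r2)
qed

definition pick_prog :: com where
  "pick_prog = While (Less (Lit 1) (Reg 1)) pick_step"

text \<open>The recursion of \<open>pick\<close> becomes a loop because register 3 accumulates the
  offset; hence \<open>lo\<close> is arbitrary. The size drops by at least 1 per pass, so
  \<open>p\<close> passes, each charged like the first, bound the time.\<close>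

lemma exec_pick_prog:
  assumes "\<rho> 1 = p" "\<rho> 2 = N" "\<rho> 3 = lo" "1 \<le> p"
  shows "\<exists>\<rho>'. exec_le pick_prog (\<rho>, M) (1 + p * (12 + 3 * p + 6 * N)) (\<rho>', M) \<and> \<rho>' 3 = lo + pick p N"
  using assms
proof (induction p N arbitrary: \<rho> lo rule: pick.induct)
  case (1 p N)
  show ?case
  proof (cases "p \<le> 1")
    case True
    then have "exec_le pick_prog (\<rho>, M) (1 + p * (12 + 3 * p + 6 * N)) (\<rho>, M)"
      unfolding pick_prog_def using 1(3) by (intro exec_le_mono[OF exec_le_WhileFalse]) simp_all
    then show ?thesis using True 1(5) by (intro exI[of _ \<rho>]) (simp add: pick.simps)
  next
    case False
    define a q where "a = p div 2" and "q = N * a div p"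
    have a: "1 \<le> a" "a < p" "1 \<le> p - a" using False by (auto simp: a_def)
    have "q \<le> N * p div p" unfolding q_def using a by (intro div_le_mono mult_le_mono) auto
    then have qN: "q \<le> N" using a by simp
    obtain \<rho>1 where step: "exec_le pick_step (\<rho>, M) (11 + 3 * p + 6 * N) (\<rho>1, M)"
      and \<rho>1: "if N * a mod p + a < p then \<rho>1 1 = p - a \<and> \<rho>1 2 = N - q \<and> \<rho>1 3 = lo + a
        else \<rho>1 1 = a \<and> \<rho>1 2 = q \<and> \<rho>1 3 = lo"
      using exec_pick_step[of p \<rho> N lo M] 1 False unfolding a_def q_def by auto
    \<comment> \<open>Common to both branches: the remaining subtree has size at most
      \<open>p - 1\<close> and index at most \<open>N\<close>, so its bound plus the present pass
      fits the bound for \<open>p\<close>.\<close>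
    have whole: ?thesis
      if ih: "exec_le pick_prog (\<rho>1, M) (1 + p' * (12 + 3 * p' + 6 * N')) (\<rho>', M)"
        and "\<rho>' 3 = lo + pick p N" "p' \<le> p - 1" "N' \<le> N" for p' N' \<rho>'
    proof (intro exI[of _ \<rho>'] conjI)
      have "p' * (12 + 3 * p' + 6 * N') \<le> (p - 1) * (12 + 3 * p + 6 * N)"
        using that by (intro mult_le_mono add_mono) auto
      moreover have "p * (12 + 3 * p + 6 * N) = (12 + 3 * p + 6 * N) + (p - 1) * (12 + 3 * p + 6 * N)"
        using False by (cases p) auto
      moreover have "exec_le pick_prog (\<rho>, M)
          (1 + (11 + 3 * p + 6 * N) + (1 + p' * (12 + 3 * p' + 6 * N'))) (\<rho>', M)"
        using ih step unfolding pick_prog_def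
        by (intro exec_le_WhileTrue[where s' = "(\<rho>1, M)"]) (use 1(3) False in simp_all)
      ultimately show "exec_le pick_prog (\<rho>, M) (1 + p * (12 + 3 * p + 6 * N)) (\<rho>', M)"
        by (elim exec_le_mono) linarith
    qed (use that in simp)
    show ?thesis
    proof (cases "N * a mod p + a < p")
      case True
      then have p: "pick p N = a + pick (p - a) (N - q)"
        using False by (simp add: pick.simps[of p] Let_def a_def q_def)
      obtain \<rho>' where "exec_le pick_prog (\<rho>1, M) (1 + (p - a) * (12 + 3 * (p - a) + 6 * (N - q))) (\<rho>', M)"
        "\<rho>' 3 = lo + a + pick (p - a) (N - q)"
        using 1(1)[OF False a_def q_def True, of \<rho>1 "lo + a"] \<rho>1 True a by auto
      then show ?thesis using a by (intro whole[of "p - a" "N - q" \<rho>']) (auto simp: p)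
    next
      case F: False
      then have p: "pick p N = pick a q"
        using False by (simp add: pick.simps[of p] Let_def a_def q_def)
      obtain \<rho>' where "exec_le pick_prog (\<rho>1, M) (1 + a * (12 + 3 * a + 6 * q)) (\<rho>', M)"
        "\<rho>' 3 = lo + pick a q"
        using 1(2)[OF False a_def q_def F, of \<rho>1 lo] \<rho>1 F a by auto
      then show ?thesis using a qN by (intro whole[of a q \<rho>']) (auto simp: p)
    qed
  qed
qed

section \<open>Locating the winner in the input\<close>

definition add_mult_prog :: "nat \<Rightarrow> aexp \<Rightarrow> nat \<Rightarrow> com" where
  "add_mult_prog x a y =
     While (Less (Lit 0) (Reg y))
      (Seq (SetReg x (Add (Reg x) a))
           (SetReg y (Sub (Reg y) (Lit 1))))"

text \<open>Multiplication by repeated addition: register \<open>y\<close> is consumed as the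
  counter, and the summand is a memory cell, which no pass changes.\<close>

lemma exec_add_mult_prog:
  assumes "x \<noteq> y"
  shows "exec_le (add_mult_prog x (Mem (Lit k)) y) (\<rho>, M) (1 + 3 * \<rho> y)
    (\<rho>(x := \<rho> x + \<rho> y * M k, y := 0), M)"
proof -
  define f where "f i = (\<rho>(x := \<rho> x + i * M k, y := \<rho> y - i), M)" for i
  have step: "exec_le (Seq (SetReg x (Add (Reg x) (Mem (Lit k)))) (SetReg y (Sub (Reg y) (Lit 1))))
      (f i) (1 + 1) (f (Suc i))" for i
    unfolding f_def using assms
    by (intro exec_le_Seq[OF exec_le_SetReg exec_le_SetReg_eq]) (auto simp: fun_eq_iff)
  have "exec_le (add_mult_prog x (Mem (Lit k)) y) (f 0) (1 + \<rho> y * (1 + (1 + 1))) (f (\<rho> y))"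
    unfolding add_mult_prog_def using assms
    by (intro exec_le_loop step) (simp_all add: f_def)
  moreover have "f 0 = (\<rho>, M)" "f (\<rho> y) = (\<rho>(x := \<rho> x + \<rho> y * M k, y := 0), M)"
    by (simp_all add: f_def)
  ultimately show ?thesis by (auto elim: exec_le_mono)
qed

text \<open>Ranking number \<open>N * n + v\<close> is that of voter \<open>v\<close> in round
  \<open>N\<close>. It starts behind three header cells, the \<open>n\<close> cells of the voter
  order and that many rankings of \<open>m\<close> entries; its first entry is the
  favourite.\<close>

definition rule_prog :: com where
  "rule_prog =
     Seq (SetReg 1 (Mem (Lit 0)))
    (Seq (SetReg 2 (Sub (Mem (Lit 2)) (Lit 1)))
    (Seq pick_prog
    (Seq (SetReg 4 (Mem (Add (Lit 3) (Reg 3))))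
    (Seq (SetReg 5 (Sub (Mem (Lit 2)) (Lit 1)))
    (Seq (add_mult_prog 4 (Mem (Lit 0)) 5)
    (Seq (SetReg 6 (Add (Lit 3) (Mem (Lit 0))))
    (Seq (add_mult_prog 6 (Mem (Lit 1)) 4)
         (SetReg 0 (Mem (Reg 6))))))))))"

lemma exec_rule_prog:
  assumes n: "M 0 = n" "1 \<le> n" and T: "M 2 - 1 = N"
    and v: "M (3 + pick n N) = v" "v < n"
  shows "\<exists>\<rho>'. exec_le rule_prog (\<lambda>_. 0, M) (9 + n * (18 + 3 * n + 12 * N) + 3 * N) (\<rho>', M) \<and>
    \<rho>' 0 = M (3 + n + (N * n + v) * M 1)"
proof -
  define \<rho>1 :: "nat \<Rightarrow> nat" where "\<rho>1 = (\<lambda>_. 0)(1 := n, 2 := N)"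
  have "\<rho>1 1 = n" "\<rho>1 2 = N" "\<rho>1 3 = 0" by (simp_all add: \<rho>1_def)
  then obtain \<rho>2 where 3: "exec_le pick_prog (\<rho>1, M) (1 + n * (12 + 3 * n + 6 * N)) (\<rho>2, M)"
    and r2: "\<rho>2 3 = pick n N"
    using exec_pick_prog[of \<rho>1 n N 0 M] n by auto
  define \<rho>4 where "\<rho>4 = \<rho>2(4 := v)"
  define \<rho>5 where "\<rho>5 = \<rho>4(5 := N)"
  define \<rho>6 where "\<rho>6 = \<rho>5(4 := v + N * n, 5 := 0)"
  define \<rho>7 where "\<rho>7 = \<rho>6(6 := 3 + n)"
  define \<rho>8 where "\<rho>8 = \<rho>7(6 := 3 + n + (v + N * n) * M 1, 4 := 0)"
  define \<rho>9 where "\<rho>9 = \<rho>8(0 := M (3 + n + (v + N * n) * M 1))"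
  have 1: "exec_le (SetReg 1 (Mem (Lit 0))) (\<lambda>_. 0, M) 1 ((\<lambda>_. 0)(1 := n), M)"
    by (rule exec_le_SetReg_eq) (simp add: n)
  have 2: "exec_le (SetReg 2 (Sub (Mem (Lit 2)) (Lit 1))) ((\<lambda>_. 0)(1 := n), M) 1 (\<rho>1, M)"
    unfolding \<rho>1_def by (rule exec_le_SetReg_eq) (use T in simp)
  have 4: "exec_le (SetReg 4 (Mem (Add (Lit 3) (Reg 3)))) (\<rho>2, M) 1 (\<rho>4, M)"
    unfolding \<rho>4_def by (rule exec_le_SetReg_eq) (use v in \<open>simp add: r2\<close>)
  have 5: "exec_le (SetReg 5 (Sub (Mem (Lit 2)) (Lit 1))) (\<rho>4, M) 1 (\<rho>5, M)"
    unfolding \<rho>5_def by (rule exec_le_SetReg_eq) (use T in simp)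
  have 6: "exec_le (add_mult_prog 4 (Mem (Lit 0)) 5) (\<rho>5, M) (1 + 3 * N) (\<rho>6, M)"
    using exec_add_mult_prog[of 4 5 0 \<rho>5 M] by (simp add: \<rho>6_def \<rho>5_def \<rho>4_def n)
  have 7: "exec_le (SetReg 6 (Add (Lit 3) (Mem (Lit 0)))) (\<rho>6, M) 1 (\<rho>7, M)"
    unfolding \<rho>7_def by (rule exec_le_SetReg_eq) (simp add: n)
  have 8: "exec_le (add_mult_prog 6 (Mem (Lit 1)) 4) (\<rho>7, M) (1 + 3 * (v + N * n)) (\<rho>8, M)"
    using exec_add_mult_prog[of 6 4 1 \<rho>7 M] by (simp add: \<rho>8_def \<rho>7_def \<rho>6_def)
  have 9: "exec_le (SetReg 0 (Mem (Reg 6))) (\<rho>8, M) 1 (\<rho>9, M)"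
    unfolding \<rho>9_def by (rule exec_le_SetReg_eq) (simp add: \<rho>8_def)
  have "exec_le rule_prog (\<lambda>_. 0, M)
      (1 + (1 + ((1 + n * (12 + 3 * n + 6 * N)) + (1 + (1 + ((1 + 3 * N) + (1 + ((1 + 3 * (v + N * n)) + 1)))))))) (\<rho>9, M)"
    unfolding rule_prog_def by (rule exec_le_Seq 1 2 3 4 5 6 7 8 9)+
  then have "exec_le rule_prog (\<lambda>_. 0, M) (9 + n * (18 + 3 * n + 12 * N) + 3 * N) (\<rho>9, M)"
    by (rule exec_le_mono) (use v in \<open>simp add: algebra_simps\<close>)
  then show ?thesis
    by (intro exI[of _ \<rho>9]) (simp add: \<rho>9_def add.commute)
qed

text \<open>Row-major addressing, used both for the rankings within the rounds and for the entries
  within the rankings.\<close>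

lemma nth_concat_uniform:
  assumes "\<And>x. x \<in> set xs \<Longrightarrow> length x = k" "i < length xs" "r < k"
  shows "concat xs ! (i * k + r) = xs ! i ! r"
  using assms
proof (induction xs arbitrary: i)
  case (Cons x xs)
  show ?case
  proof (cases i)
    case 0
    then show ?thesis using Cons.prems by (simp add: nth_append)
  next
    case (Suc i')
    then have "concat xs ! (i' * k + r) = xs ! i' ! r"
      using Cons.prems by (intro Cons.IH) auto
    then show ?thesis using Suc Cons.prems(1)[of x] by (simp add: nth_append)
  qed
qed simp

lemma length_concat_uniform:
  "(\<And>x. x \<in> set xs \<Longrightarrow> length x = k) \<Longrightarrow> length (concat xs) = length xs * k"
  by (induction xs) auto

lemma polytime_interleaved_rule: "polytime_rule interleaved_rule"
  unfolding polytime_rule_def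
\<comment> \<open>The polynomial is the bound of \<open>exec_rule_prog\<close> with \<open>n\<close>
  and \<open>N\<close> replaced by the input length \<open>l\<close>:
  \<open>9 + l * (18 + 15 * l) + 3 * l\<close>.\<close>
proof (intro exI[of _ rule_prog] exI[of _ "[:9, 21, 15:]"] allI impI, elim conjE)
  fix n m \<sigma> P assume a: "is_voter_order n \<sigma>" "is_profile n m P"
  define xs where "xs = encode \<sigma> P"
  define M where "M = snd (init_state xs)"
  define N where "N = length P - 1"
  define v where "v = \<sigma> ! pick n N"
  have P: "1 \<le> n" "1 \<le> m" "N < length P" "P \<noteq> []" "length P = Suc N"
    using a(2) by (auto simp: is_profile_def N_def)
  have len: "length \<sigma> = n" using a(1) by (rule is_voter_order_length)
  have lB: "length B = n" if "B \<in> set P" for B using a(2) that by (auto simp: is_profile_def)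
  have lr: "length r = m" if "r \<in> set (concat P)" for r
    using a(2) that is_ranking_length by (auto simp: is_profile_def)
  have lc: "length (concat P) = length P * n" using lB by (rule length_concat_uniform)
  have lcc: "length (concat (concat P)) = length P * n * m"
    using length_concat_uniform[of "concat P" m] lr lc by simp
  have pn: "pick n N < n" using P(1) by (rule pick_less)
  have vn: "v < n" unfolding v_def using a(1) pn by (rule is_voter_order_nth)
  have P00: "length (P ! 0 ! 0) = m"
    using is_profile_ranking[OF a(2), of 0 0] P is_ranking_length by auto
  have xs: "xs = n # m # length P # \<sigma> @ concat (concat P)"
    unfolding xs_def encode_def len P00 by simp
  have lxs: "length xs = 3 + n + length P * n * m" by (simp add: xs len lcc)
  have M: "M k = (if k < length xs then xs ! k else 0)" for k by (simp add: M_def init_state_def)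
  have M0: "M 0 = n" "M 1 = m" "M 2 = length P" by (simp_all add: M xs)
  have Mv: "M (3 + pick n N) = v"
    using pn by (simp add: M xs v_def nth_append len eval_nat_numeral)
  have idx: "N * n + v < length (concat P)"
    using vn by (simp add: lc P(5))
  have "(N * n + v) * m < length (concat P) * m" using idx P(2) by simp
  \<comment> \<open>The added 0 is the offset of the favourite within its ranking, in the form that
    \<open>nth_concat_uniform\<close> expects.\<close>
  then have "M (3 + n + (N * n + v) * m) = concat (concat P) ! ((N * n + v) * m + 0)"
    using lcc lc by (simp add: M xs nth_append len eval_nat_numeral)
  also have "\<dots> = concat P ! (N * n + v) ! 0"
    using lr idx P(2) by (intro nth_concat_uniform) auto
  also have "concat P ! (N * n + v) = P ! N ! v"
    using lB P(3) vn by (intro nth_concat_uniform) auto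
  also have "P ! N ! v ! 0 = interleaved_rule \<sigma> P"
    using outcome_last[OF P(4), of interleaved_rule \<sigma>] outcome_interleaved_rule[OF a P(3)]
    by (simp add: v_def N_def)
  finally have out: "M (3 + n + (N * n + v) * m) = interleaved_rule \<sigma> P" .
  have "M 2 - 1 = N" using M0 by (simp add: N_def)
  then obtain \<rho>' where "exec_le rule_prog (\<lambda>_. 0, M) (9 + n * (18 + 3 * n + 12 * N) + 3 * N) (\<rho>', M)"
    and \<rho>': "\<rho>' 0 = interleaved_rule \<sigma> P"
    using exec_rule_prog[OF M0(1) P(1) _ Mv vn] out unfolding M0(2) by auto
  then obtain t where t: "t \<le> 9 + n * (18 + 3 * n + 12 * N) + 3 * N"
    and ex: "exec rule_prog (\<lambda>_. 0, M) t (\<rho>', M)"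
    by (auto simp: exec_le_def)
  have "init_state xs = (\<lambda>_. 0, M)" by (simp add: M_def init_state_def)
  moreover have "t \<le> poly [:9, 21, 15:] (length xs)"
  proof -
    define l where "l = length xs"
    have "length P * 1 * 1 \<le> length P * n * m" using P by (intro mult_le_mono) auto
    then have "n \<le> l" "N \<le> l" using P(5) lxs by (auto simp: l_def)
    then have "9 + n * (18 + 3 * n + 12 * N) + 3 * N \<le> 9 + l * (18 + 3 * l + 12 * l) + 3 * l"
      by (intro add_mono mult_le_mono order.refl)
    with t have "t \<le> 9 + l * (18 + 3 * l + 12 * l) + 3 * l" by linarith
    also have "\<dots> = poly [:9, 21, 15:] l" by (simp add: algebra_simps)
    finally show ?thesis by (simp add: l_def)
  qed
  ultimately show "\<exists>t s. exec rule_prog (init_state (encode \<sigma> P)) t s \<and>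
      fst s 0 = interleaved_rule \<sigma> P \<and> t \<le> poly [:9, 21, 15:] (length (encode \<sigma> P))"
    using ex \<rho>' unfolding xs_def by (intro exI[of _ t] exI[of _ "(\<rho>', M)"]) simp
qed

section \<open>Lower bound on the discrepancy of sequences\<close>

definition counting :: "(nat \<Rightarrow> nat) \<Rightarrow> nat \<Rightarrow> nat \<Rightarrow> nat" where
  "counting w k T = card {j. j < T \<and> w j < k}"

definition discrepancy :: "(nat \<Rightarrow> nat) \<Rightarrow> nat \<Rightarrow> nat \<Rightarrow> nat \<Rightarrow> real" where
  "discrepancy w n k T = counting w k T - real T * k / n"

text \<open>Windows contain both ends, so they are nonempty even for \<open>l = 0\<close> and
  extrema are attained.\<close>

definition peak :: "(nat \<Rightarrow> real) \<Rightarrow> nat \<Rightarrow> nat \<Rightarrow> real" where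
  "peak g t l = Max (g ` {t..t + l})"

definition valley :: "(nat \<Rightarrow> real) \<Rightarrow> nat \<Rightarrow> nat \<Rightarrow> real" where
  "valley g t l = Min (g ` {t..t + l})"

lemma peak_mono: "t \<le> t' \<Longrightarrow> t' + l' \<le> t + l \<Longrightarrow> peak g t' l' \<le> peak g t l"
  unfolding peak_def by (intro Max_mono image_mono) auto

lemma valley_mono: "t \<le> t' \<Longrightarrow> t' + l' \<le> t + l \<Longrightarrow> valley g t l \<le> valley g t' l'"
  unfolding valley_def by (intro Min_antimono image_mono) auto

lemma peak_valley_attained:
  obtains T U where "T \<in> {t..t + l}" "peak g t l = g T" "U \<in> {t..t + l}" "valley g t l = g U"
proof -
  have "peak g t l \<in> g ` {t..t + l}" "valley g t l \<in> g ` {t..t + l}"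
    unfolding peak_def valley_def by (auto intro!: Max_in Min_in)
  then show ?thesis using that by blast
qed

lemma peak_ge: "T \<in> {t..t + l} \<Longrightarrow> g T \<le> peak g t l"
  unfolding peak_def by auto

lemma valley_le: "T \<in> {t..t + l} \<Longrightarrow> valley g t l \<le> g T"
  unfolding valley_def by auto

section \<open>Oscillations and their midpoints\<close>

definition oscillation :: "(nat \<Rightarrow> real) \<Rightarrow> nat \<Rightarrow> nat \<Rightarrow> real" where
  "oscillation g t l = peak g t l - valley g t l"

definition midpoint :: "(nat \<Rightarrow> real) \<Rightarrow> nat \<Rightarrow> nat \<Rightarrow> real" where
  "midpoint g t l = (peak g t l + valley g t l) / 2"

lemma oscillation_nonneg: "0 \<le> oscillation g t l"
  using peak_ge[of t t l g] valley_le[of t t l g] by (simp add: oscillation_def)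

text \<open>The range over the large window contains the ranges over its outer quarters. The hull of
  two intervals is at least as long as the mean of their lengths plus the distance of their
  midpoints.\<close>

lemma oscillation_split:
  "oscillation g t (4 * l) \<ge>
     (oscillation g t l + oscillation g (t + 3 * l) l) / 2 +
     \<bar>midpoint g (t + 3 * l) l - midpoint g t l\<bar>"
  using peak_mono[of t t l "4 * l" g] peak_mono[of t "t + 3 * l" l "4 * l" g]
    valley_mono[of t t l "4 * l" g] valley_mono[of t "t + 3 * l" l "4 * l" g]
  unfolding oscillation_def midpoint_def abs_if by (simp add: field_simps)

text \<open>On the window \<open>h - g\<close> stays between two constants; hence peaks, valleys and
  midpoints differ by amounts between the same constants.\<close>

lemma midpoint_drift:
  assumes "\<And>T. T \<in> {t..t + l} \<Longrightarrow> h T = g T + c - real T * \<epsilon>" "0 \<le> \<epsilon>"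
  shows "midpoint h t l - midpoint g t l \<in> {c - real (t + l) * \<epsilon> .. c - real t * \<epsilon>}"
proof -
  define lo hi where "lo = c - real (t + l) * \<epsilon>" and "hi = c - real t * \<epsilon>"
  have b: "g T + lo \<le> h T" "h T \<le> g T + hi" if "T \<in> {t..t + l}" for T
  proof -
    have "real t * \<epsilon> \<le> real T * \<epsilon>" "real T * \<epsilon> \<le> real (t + l) * \<epsilon>"
      using that assms(2) by (auto intro!: mult_right_mono simp flip: of_nat_add)
    then show "g T + lo \<le> h T" "h T \<le> g T + hi"
      unfolding assms(1)[OF that] lo_def hi_def by simp_all
  qed
  obtain T U where g: "T \<in> {t..t + l}" "peak g t l = g T" "U \<in> {t..t + l}" "valley g t l = g U"
    by (rule peak_valley_attained)
  obtain T' U' where h: "T' \<in> {t..t + l}" "peak h t l = h T'" "U' \<in> {t..t + l}" "valley h t l = h U'"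
    by (rule peak_valley_attained)
  \<comment> \<open>Each function is compared at the points where the other is extremal.\<close>
  have "h T \<le> h T'" "h U' \<le> h U" "g T' \<le> g T" "g U \<le> g U'"
    using peak_ge[OF g(1), of h] valley_le[OF g(3), of h] peak_ge[OF h(1), of g] valley_le[OF h(3), of g]
      g h by simp_all
  then have "h T' + h U' \<le> g T + g U + 2 * hi" "g T + g U + 2 * lo \<le> h T' + h U'"
    using b[OF g(1)] b[OF g(3)] b[OF h(1)] b[OF h(3)] by linarith+
  then show ?thesis
    unfolding midpoint_def g(2,4) h(2,4) lo_def[symmetric] hi_def[symmetric] by (simp add: field_simps)
qed

definition mid_shift :: "(nat \<Rightarrow> real) \<Rightarrow> nat \<Rightarrow> nat \<Rightarrow> real" where
  "mid_shift g t l = midpoint g (t + 3 * l) l - midpoint g t l"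

text \<open>The two functions differ by a drift of speed \<open>\<epsilon>\<close> on the window, so the distances that their
  midpoints travel between the outer subwindows cannot both be small.\<close>
lemma mid_shift_drift:
  assumes "\<And>T. T \<in> {t..t + 4 * l} \<Longrightarrow> h T = g T + c - real T * \<epsilon>" "0 \<le> \<epsilon>"
  shows "2 * real l * \<epsilon> \<le> \<bar>mid_shift g t l\<bar> + \<bar>mid_shift h t l\<bar>"
proof -
  have "midpoint h t l - midpoint g t l \<in> {c - real (t + l) * \<epsilon> .. c - real t * \<epsilon>}"
    using assms by (intro midpoint_drift) auto
  moreover have "midpoint h (t + 3 * l) l - midpoint g (t + 3 * l) l
      \<in> {c - real ((t + 3 * l) + l) * \<epsilon> .. c - real (t + 3 * l) * \<epsilon>}"
    using assms by (intro midpoint_drift) auto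
  \<comment> \<open>The constant \<open>c\<close> cancels. The first quarter ends
    \<open>2 * l\<close> before the last one begins, and the drift over this gap is certain.\<close>
  ultimately have "mid_shift h t l - mid_shift g t l \<le> - 2 * real l * \<epsilon>"
    unfolding mid_shift_def by (simp add: algebra_simps)
  then show ?thesis by linarith
qed

text \<open>The band \<open>[k, k + e)\<close> gains no point between the times \<open>t\<close> and
  \<open>u\<close>, so its count is frozen at the value it has at time \<open>t\<close>.\<close>

lemma counting_shift:
  assumes "t \<le> T" "T \<le> u" "\<And>j. t \<le> j \<Longrightarrow> j < u \<Longrightarrow> w j \<notin> {k..<k + e}"
  shows "real (counting w (k + e) T) - counting w k T = real (card {j. j < t \<and> w j \<in> {k..<k + e}})"
proof -
  have mem: "j < T \<and> w j < k + e \<longleftrightarrow> j < T \<and> w j < k \<or> j < t \<and> w j \<in> {k..<k + e}" for j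
  proof (cases "j < t")
    case True
    then show ?thesis using assms(1) by auto
  next
    case False
    then have "j < T \<Longrightarrow> w j \<notin> {k..<k + e}" using assms(2) assms(3)[of j] by linarith
    then show ?thesis using False by auto
  qed
  have "counting w (k + e) T = card ({j. j < T \<and> w j < k} \<union> {j. j < t \<and> w j \<in> {k..<k + e}})"
    unfolding counting_def mem Collect_disj_eq ..
  also have "\<dots> = counting w k T + card {j. j < t \<and> w j \<in> {k..<k + e}}"
    unfolding counting_def by (rule card_Un_disjoint) auto
  finally show ?thesis by simp
qed

text \<open>While the band receives nothing, the two discrepancies differ by a constant minus the
  growing share of the band: a drift of speed \<open>e / n\<close>.\<close>

lemma discrepancy_mid_shift:
  assumes "\<And>j. t \<le> j \<Longrightarrow> j < t + 4 * l \<Longrightarrow> w j \<notin> {k..<k + e}"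
  shows "2 * real l * (real e / real n)
    \<le> \<bar>mid_shift (discrepancy w n k) t l\<bar> + \<bar>mid_shift (discrepancy w n (k + e)) t l\<bar>"
proof (rule mid_shift_drift)
  fix T assume "T \<in> {t..t + 4 * l}"
  then have "real (counting w (k + e) T) - counting w k T = real (card {j. j < t \<and> w j \<in> {k..<k + e}})"
    using assms by (intro counting_shift[of t T "t + 4 * l"]) simp_all
  moreover have "real T * real (k + e) / n = real T * k / n + real T * (real e / real n)"
    by (simp add: distrib_left add_divide_distrib)
  ultimately show "discrepancy w n (k + e) T =
      discrepancy w n k T + real (card {j. j < t \<and> w j \<in> {k..<k + e}}) - real T * (real e / real n)"
    unfolding discrepancy_def by linarith
qed simp

text \<open>The width \<open>e\<close> is about \<open>n / (8 * l)\<close>: so small that the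
  \<open>4 * l\<close> points of the window hit the bands of at most \<open>n / 2\<close>
  thresholds, and so large that the drift \<open>2 * l * e / n\<close> is at least 1/8. At least
  \<open>n / 4\<close> thresholds remain and each shift is used at most twice, so the constant is
  1/4 * 1/8 * 1/2.\<close>

lemma sum_mid_shift_ge:
  fixes n l :: nat
  assumes "1 \<le> l" "8 * l \<le> n"
  shows "(\<Sum>k<n. \<bar>mid_shift (discrepancy w n k) t l\<bar>) \<ge> n / 64"
proof -
  define e where "e = n div (8 * l)"
  define s where "s k = \<bar>mid_shift (discrepancy w n k) t l\<bar>" for k
  \<comment> \<open>At most \<open>4 l e \<le> n / 2\<close> thresholds \<open>k\<close> see a point in \<open>[k, k + e)\<close> during the window.\<close>
  define X where "X = (\<Union>j\<in>{t..<t + 4 * l}. {k. k \<le> w j \<and> w j < k + e})"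
  \<comment> \<open>Leaving out the last \<open>e\<close> thresholds keeps \<open>k + e\<close>
    below \<open>n\<close>.\<close>
  define G where "G = {..<n - e} - X"
  have e: "8 * l * e \<le> n" "n < 8 * l * (e + 1)"
    unfolding e_def using assms dividend_less_times_div[of "8 * l" n]
      times_div_less_eq_dividend[of "8 * l" n]
    by (simp_all add: algebra_simps)
  have "1 \<le> e" unfolding e_def using assms by (simp add: div_greater_zero_iff Suc_le_eq)
  \<comment> \<open>Rounding down at most halves \<open>n / (8 * l)\<close>, because the result is
    at least 1.\<close>
  have el: "n \<le> 16 * l * e"
  proof -
    have "8 * l * (e + 1) \<le> 8 * l * (2 * e)" using \<open>1 \<le> e\<close> by (intro mult_le_mono2) simp
    then show ?thesis using e(2) by linarith
  qed
  have fin: "finite {k. k \<le> v \<and> v < k + e}" for v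
    by (rule finite_subset[of _ "{..v}"]) auto
  have card1: "card {k. k \<le> v \<and> v < k + e} \<le> e" for v
  proof -
    have "{k. k \<le> v \<and> v < k + e} \<subseteq> (\<lambda>i. v - i) ` {..<e}"
    proof
      fix k assume "k \<in> {k. k \<le> v \<and> v < k + e}"
      then have "k = v - (v - k)" "v - k \<in> {..<e}" by auto
      then show "k \<in> (\<lambda>i. v - i) ` {..<e}" by blast
    qed
    then have "card {k. k \<le> v \<and> v < k + e} \<le> card ((\<lambda>i. v - i) ` {..<e})" by (intro card_mono) auto
    also have "\<dots> \<le> e" using card_image_le[of "{..<e}" "\<lambda>i. v - i"] by simp
    finally show ?thesis .
  qed
  have "card X \<le> (\<Sum>j\<in>{t..<t + 4 * l}. card {k. k \<le> w j \<and> w j < k + e})"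
    unfolding X_def by (intro card_UN_le) simp
  also have "\<dots> \<le> (\<Sum>j\<in>{t..<t + 4 * l}. e)" by (intro sum_mono card1)
  finally have X: "card X \<le> 4 * l * e" by simp
  have "finite X" unfolding X_def using fin by auto
  then have "n - e - card X \<le> card G"
    unfolding G_def using diff_card_le_card_Diff[of X "{..<n - e}"] by simp
  moreover have "8 * e \<le> n"
  proof -
    have "8 * 1 * e \<le> 8 * l * e" using assms by (intro mult_le_mono) auto
    then show ?thesis using e(1) by linarith
  qed
  ultimately have G: "n \<le> 4 * card G" using X e(1) by linarith
  have "n / 64 \<le> card G * (1 / 8) / 2" using G by simp
  also have "card G * (1 / 8) = (\<Sum>k\<in>G. 1 / 8 :: real)" by simp
  also have "\<dots> \<le> (\<Sum>k\<in>G. s k + s (k + e))"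
  proof (rule sum_mono)
    fix k assume "k \<in> G"
    then have "2 * real l * (real e / real n) \<le> s k + s (k + e)"
      unfolding s_def by (intro discrepancy_mid_shift) (auto simp: G_def X_def)
    moreover have "1 / 8 \<le> 2 * real l * (real e / real n)"
    proof -
      have "real n \<le> real (16 * l * e)" using el by (rule of_nat_mono)
      then show ?thesis using assms by (simp add: field_simps)
    qed
    ultimately show "1 / 8 \<le> s k + s (k + e)" by linarith
  qed
  also have "\<dots> = (\<Sum>k\<in>G. s k) + (\<Sum>k\<in>(\<lambda>k. k + e) ` G. s k)"
    by (simp add: sum.distrib sum.reindex)
  also have "\<dots> \<le> (\<Sum>k<n. s k) + (\<Sum>k<n. s k)"
    by (intro add_mono sum_mono2) (auto simp: G_def s_def)
  finally show ?thesis by (simp add: s_def)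
qed

text \<open>Quadrupling the window adds the summed midpoint shifts, which are at least
  \<open>n / 64\<close>. The start \<open>t\<close> is arbitrary because the induction hypothesis is
  applied to both outer quarters.\<close>

lemma sum_oscillation_ge:
  assumes "i = 0 \<or> 2 * 4 ^ i \<le> n"
  shows "(\<Sum>k<n. oscillation (discrepancy w n k) t (4 ^ i)) \<ge> real i * real n / 64"
  using assms
proof (induction i arbitrary: t)
  case 0
  then show ?case by (auto intro: sum_nonneg oscillation_nonneg)
next
  case (Suc i)
  define l :: nat where "l = 4 ^ i"
  have l: "1 \<le> l" "8 * l \<le> n" using Suc.prems by (auto simp: l_def)
  have IH: "real i * real n / 64 \<le> (\<Sum>k<n. oscillation (discrepancy w n k) t l)" for t
    unfolding l_def using Suc l by (auto simp: l_def)
  have "real (Suc i) * real n / 64 \<le> (real i * real n / 64 + real i * real n / 64) / 2 + n / 64"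
    by (simp add: field_simps)
  also have "\<dots> \<le> ((\<Sum>k<n. oscillation (discrepancy w n k) t l)
      + (\<Sum>k<n. oscillation (discrepancy w n k) (t + 3 * l) l)) / 2
      + (\<Sum>k<n. \<bar>mid_shift (discrepancy w n k) t l\<bar>)"
    by (intro add_mono divide_right_mono IH sum_mid_shift_ge l) auto
  also have "\<dots> = (\<Sum>k<n. (oscillation (discrepancy w n k) t l
      + oscillation (discrepancy w n k) (t + 3 * l) l) / 2
      + \<bar>mid_shift (discrepancy w n k) t l\<bar>)"
    by (simp add: sum.distrib flip: sum_divide_distrib)
  also have "\<dots> \<le> (\<Sum>k<n. oscillation (discrepancy w n k) t (4 * l))"
    unfolding mid_shift_def by (intro sum_mono oscillation_split)
  finally show ?case by (simp add: l_def)
qed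

text \<open>Each oscillation is at most \<open>2 * b\<close>, so averaging over the \<open>n\<close>
  thresholds gives \<open>i / 64 \<le> 2 * b\<close>.\<close>

lemma discrepancy_lower_bound:
  assumes "1 \<le> n" "\<And>k T. k < n \<Longrightarrow> \<bar>discrepancy w n k T\<bar> \<le> b" "2 * 4 ^ i \<le> n"
  shows "i / 128 \<le> b"
proof -
  have osc: "oscillation (discrepancy w n k) t l \<le> 2 * b" if "k < n" for k t l
  proof -
    obtain T U where "peak (discrepancy w n k) t l = discrepancy w n k T"
      "valley (discrepancy w n k) t l = discrepancy w n k U"
      by (rule peak_valley_attained)
    then show ?thesis using assms(2)[OF that, of T] assms(2)[OF that, of U]
      by (simp add: oscillation_def)
  qed
  have "real i * real n / 64 \<le> (\<Sum>k<n. oscillation (discrepancy w n k) 0 (4 ^ i))"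
    using assms by (intro sum_oscillation_ge) auto
  also have "\<dots> \<le> (\<Sum>k<n. 2 * b)" by (intro sum_mono osc) auto
  finally show ?thesis using assms(1) by (simp add: field_simps)
qed

section \<open>Line profiles\<close>

text \<open>The rankings that arise when voter \<open>i\<close> and candidate \<open>i\<close> are both placed at \<open>2 ^ i\<close>.\<close>
definition line_ranking :: "nat \<Rightarrow> nat \<Rightarrow> ranking" where
  "line_ranking n i = rev [0..<Suc i] @ [Suc i..<n]"

definition line_ballots :: "nat \<Rightarrow> ballots" where
  "line_ballots n = map (line_ranking n) [0..<n]"

definition nearer :: "nat \<Rightarrow> nat \<Rightarrow> nat \<Rightarrow> bool" where
  "nearer i a b \<longleftrightarrow> \<bar>2 ^ i - 2 ^ a :: real\<bar> < \<bar>2 ^ i - 2 ^ b\<bar>"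

text \<open>The midpoint of \<open>2 ^ a\<close> and \<open>2 ^ b\<close> lies strictly between
  \<open>2 ^ (b - 1)\<close> and \<open>2 ^ b\<close>, so exactly the voters below \<open>b\<close>
  are nearer to \<open>a\<close>, without ties.\<close>

lemma nearer_iff:
  assumes "a < b"
  shows "nearer i a b \<longleftrightarrow> i < b" "nearer i b a \<longleftrightarrow> b \<le> i"
proof -
  have lt: "(2::real) ^ a < 2 ^ b" using assms by simp
  have "nearer i a b \<and> \<not> nearer i b a" if "i < b"
  proof -
    have "2 * (2::real) ^ i \<le> 2 ^ b" using power_increasing[of "Suc i" b "2::real"] that by simp
    moreover have "(0::real) < 2 ^ a" by simp
    ultimately show ?thesis unfolding nearer_def using lt by (intro conjI) linarith+
  qed
  moreover have "nearer i b a \<and> \<not> nearer i a b" if "b \<le> i"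
  proof -
    have "(2::real) ^ b \<le> 2 ^ i" using that by (intro power_increasing) auto
    then show ?thesis unfolding nearer_def using lt by (intro conjI) linarith+
  qed
  ultimately show "nearer i a b \<longleftrightarrow> i < b" "nearer i b a \<longleftrightarrow> b \<le> i"
    by (meson not_le)+
qed

lemma nearer_asym: "nearer i a b \<Longrightarrow> \<not> nearer i b a"
  by (simp add: nearer_def)

lemma is_ranking_line: "i < n \<Longrightarrow> is_ranking n (line_ranking n i)"
  unfolding is_ranking_def line_ranking_def by auto

lemma sorted_line_ranking: "sorted_wrt (nearer i) (line_ranking n i)"
proof -
  have "sorted_wrt (\<lambda>a b. nearer i b a) [0..<Suc i]"
    by (rule sorted_wrt_mono_rel[OF _ sorted_wrt_upt]) (auto simp: nearer_iff)
  moreover have "sorted_wrt (nearer i) [Suc i..<n]"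
    by (rule sorted_wrt_mono_rel[OF _ sorted_wrt_upt]) (auto simp: nearer_iff)
  ultimately show ?thesis
    unfolding line_ranking_def sorted_wrt_append sorted_wrt_rev
    by (auto simp: nearer_iff simp del: upt_Suc)
qed

lemma prefers_sorted_wrt:
  assumes "sorted_wrt R r" "\<And>a b. R a b \<Longrightarrow> \<not> R b a" "a \<in> set r" "b \<in> set r"
  shows "prefers r a b \<longleftrightarrow> R a b"
proof
  assume "prefers r a b"
  then show "R a b" using assms(1) by (auto simp: prefers_def sorted_wrt_iff_nth_less)
next
  assume R: "R a b"
  obtain k l where kl: "k < length r" "l < length r" "r ! k = a" "r ! l = b"
    using assms(3,4) by (auto simp: in_set_conv_nth)
  moreover have "\<not> l < k" using kl assms(1,2) R by (auto simp: sorted_wrt_iff_nth_less)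
  moreover have "l \<noteq> k" using kl assms(2) R by auto
  ultimately show "prefers r a b" unfolding prefers_def by (metis nat_neq_iff)
qed

lemma prefers_line_ranking:
  assumes "i < n" "a < n" "b < n"
  shows "prefers (line_ranking n i) a b \<longleftrightarrow> nearer i a b"
proof (rule prefers_sorted_wrt[OF sorted_line_ranking nearer_asym])
  show "a \<in> set (line_ranking n i)" "b \<in> set (line_ranking n i)"
    using is_ranking_line[OF assms(1)] assms(2,3) by (simp_all add: is_ranking_def)
qed

text \<open>For \<open>a < b\<close> the supporters of \<open>a\<close> are the voters below
  \<open>b\<close>, a prefix, and those of \<open>b\<close> are the others, a suffix.\<close>

lemma single_crossing_line: "single_crossing_round n n [0..<n] (line_ballots n)"
  unfolding single_crossing_round_def
proof (intro allI impI)
  fix a b assume ab: "a < n" "b < n"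
  have eq: "{i. i < n \<and> prefers (line_ballots n ! i) a b} = {i. i < n \<and> nearer i a b}"
    by (rule Collect_cong, rule conj_cong) (simp_all add: line_ballots_def prefers_line_ranking ab)
  consider "a < b" | "a = b" | "b < a" by linarith
  then show "\<exists>k\<le>n. {i. i < n \<and> prefers (line_ballots n ! i) a b} = set (take k [0..<n]) \<or>
      {i. i < n \<and> prefers (line_ballots n ! i) a b} = set (drop k [0..<n])"
  proof cases
    case 1
    then have "{i. i < n \<and> nearer i a b} = set (take b [0..<n])"
      using ab by (auto simp: nearer_iff)
    then show ?thesis unfolding eq using ab(2) less_imp_le by blast
  next
    case 2
    then have "{i. i < n \<and> nearer i a b} = set (take 0 [0..<n])" by (simp add: nearer_def)
    then show ?thesis unfolding eq by blast
  next
    case 3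
    then have "{i. i < n \<and> nearer i a b} = set (drop a [0..<n])"
      using ab by (auto simp: nearer_iff)
    then show ?thesis unfolding eq using ab(1) less_imp_le by blast
  qed
qed

lemma static_euclidean_line:
  "static_euclidean n n [0..<n] (replicate T (line_ballots n))"
proof -
  have "euclidean_round n (line_ballots n)"
    unfolding euclidean_round_def
  proof (intro exI allI impI)
    fix i assume "i < n"
    then show "sorted_wrt (\<lambda>a b. \<bar>2 ^ i - 2 ^ a :: real\<bar> < \<bar>2 ^ i - 2 ^ b\<bar>) (line_ballots n ! i)"
      using sorted_line_ranking[of i n] by (simp add: line_ballots_def nearer_def[abs_def])
  qed
  then show ?thesis
    using single_crossing_line
    by (auto simp: static_euclidean_def single_crossing_def static_def)
qed

lemma is_profile_line:
  assumes "1 \<le> n" "1 \<le> T"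
  shows "is_profile n n (replicate T (line_ballots n))"
  using assms is_ranking_line by (auto simp: is_profile_def line_ballots_def)

text \<open>With these ranks the voters below any \<open>k\<close> share candidate 0 and still
  approve only candidates below \<open>k\<close>.\<close>

lemma top_set_line_prefix:
  assumes "j < T" "i < n"
  shows "top_set (replicate T (line_ballots n)) j i (Suc i) = {..i}"
  using assms by (auto simp: top_set_def line_ballots_def line_ranking_def simp del: upt_Suc)

text \<open>The mirror image: the voters from \<open>k\<close> on share candidate \<open>k\<close>
  and approve nothing below it.\<close>

lemma top_set_line_suffix:
  assumes "j < T" "i < n" "k \<le> i"
  shows "top_set (replicate T (line_ballots n)) j i (Suc (i - k)) = {k..i}"
  using assms
  by (auto simp: top_set_def line_ballots_def line_ranking_def take_rev simp del: upt_Suc)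

section \<open>From representation to prefix discrepancy\<close>

text \<open>The form suited to groups at an end of the line: a single candidate \<open>c\<close>
  witnesses coherence in all rounds, and a fixed set \<open>X\<close> encloses everything the group
  approves.\<close>

lemma all_rank_wPJR_D:
  assumes "all_rank_wPJR n m P w L"
    and "\<And>j i. j < length P \<Longrightarrow> i < n \<Longrightarrow> R j i \<in> {1..m}"
    and "S \<noteq> {}" "S \<subseteq> {..<n}"
    and c: "\<And>j i. j < length P \<Longrightarrow> i \<in> S \<Longrightarrow> c \<in> top_set P j i (R j i)"
    and X: "\<And>j i. j < length P \<Longrightarrow> i \<in> S \<Longrightarrow> top_set P j i (R j i) \<subseteq> X"
  shows "\<lfloor>real (length P) * real (card S) / real n\<rfloor> - int L \<le> int (card {j. j < length P \<and> w j \<in> X})"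
proof -
  have "(\<Inter>i\<in>S. top_set P j i (R j i)) \<noteq> {}" if "j < length P" for j
    using c[OF that] by blast
  then have "\<lfloor>real (length P) * real (card S) / real n\<rfloor> - int L
      \<le> int (card {j. j < length P \<and> w j \<in> (\<Union>i\<in>S. top_set P j i (R j i))})"
    using assms(1)[unfolded all_rank_wPJR_def, rule_format, of R S] assms(2-4) by blast
  moreover have "card {j. j < length P \<and> w j \<in> (\<Union>i\<in>S. top_set P j i (R j i))}
      \<le> card {j. j < length P \<and> w j \<in> X}"
  proof (rule card_mono)
    show "{j. j < length P \<and> w j \<in> (\<Union>i\<in>S. top_set P j i (R j i))} \<subseteq> {j. j < length P \<and> w j \<in> X}"
      using X by blast
  qed simp
  ultimately show ?thesis by linarith
qed

text \<open>The group of voters below \<open>k\<close> forces enough winners below \<open>k\<close>,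
  the group of the others enough winners from \<open>k\<close> on. Both kinds add up to
  \<open>T\<close>, so the second bound is an upper bound for the first kind. The 1 pays for the
  floor.\<close>

lemma all_rank_wPJR_line:
  assumes w: "all_rank_wPJR n n (replicate T (line_ballots n)) w L" and k: "k < n"
  shows "\<bar>discrepancy w n k T\<bar> \<le> real L + 1"
proof -
  define P where "P = replicate T (line_ballots n)"
  have T: "length P = T" by (simp add: P_def)
  have "\<lfloor>real (length P) * real (card {k..<n}) / real n\<rfloor> - int L
      \<le> int (card {j. j < length P \<and> w j \<in> {k..}})"
  \<comment> \<open>By truncated subtraction the voters below \<open>k\<close> receive rank 1, so
    the rank matrix is valid for all voters.\<close>
  proof (rule all_rank_wPJR_D[OF w[folded P_def]])
    fix i j assume "j < length P" "i \<in> {k..<n}"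
    then have "top_set P j i (Suc (i - k)) = {k..i}" "k \<le> i"
      unfolding P_def by (auto simp: top_set_line_suffix)
    then show "k \<in> top_set P j i (Suc (i - k))" "top_set P j i (Suc (i - k)) \<subseteq> {k..}"
      by auto
  qed (use k in auto)
  then have "\<lfloor>real T * real (n - k) / real n\<rfloor> - int L \<le> int (card {j. j < T \<and> w j \<in> {k..}})"
    by (simp add: T)
  then have suffix: "real T * real (n - k) / real n - 1 - L \<le> card {j. j < T \<and> k \<le> w j}"
    unfolding atLeast_iff by linarith
  have "\<lfloor>real T * real k / real n\<rfloor> - int L \<le> int (card {j. j < T \<and> w j \<in> {..<k}})"
  \<comment> \<open>For \<open>k = 0\<close> the group would be empty; the left side is then at most
    0.\<close>
  proof (cases "k = 0")
    case False
    have "\<lfloor>real (length P) * real (card {..<k}) / real n\<rfloor> - int L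
        \<le> int (card {j. j < length P \<and> w j \<in> {..<k}})"
    proof (rule all_rank_wPJR_D[OF w[folded P_def]])
      fix i j assume "j < length P" "i \<in> {..<k}"
      then have "top_set P j i (Suc i) = {..i}" "i < k"
        unfolding P_def using k by (auto simp: top_set_line_prefix)
      then show "0 \<in> top_set P j i (Suc i)" "top_set P j i (Suc i) \<subseteq> {..<k}"
        by auto
    qed (use k False in auto)
    then show ?thesis by (simp add: T)
  qed simp
  then have prefix: "real T * real k / real n - 1 - L \<le> counting w k T"
    unfolding counting_def lessThan_iff by linarith
  have "card {..<T} = card ({j. j < T \<and> w j < k} \<union> {j. j < T \<and> k \<le> w j})"
    by (rule arg_cong[where f = card]) auto
  also have "\<dots> = counting w k T + card {j. j < T \<and> k \<le> w j}"
    unfolding counting_def by (rule card_Un_disjoint) auto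
  finally have "T = counting w k T + card {j. j < T \<and> k \<le> w j}" by simp
  then have "real T = real (counting w k T) + real (card {j. j < T \<and> k \<le> w j})"
    by (metis of_nat_add)
  moreover have "real T * real (n - k) / real n = real T - real T * real k / real n"
    using k by (simp add: of_nat_diff field_simps)
  ultimately show ?thesis using prefix suffix unfolding discrepancy_def by linarith
qed

text \<open>All rounds are equal and the rule does not see the horizon, so its winners at all
  horizons are initial segments of one infinite sequence \<open>w\<close>. The loss bound at horizon
  \<open>T\<close> controls the discrepancy of \<open>w\<close> at time \<open>T\<close>, hence at
  all times.\<close>

lemma static_euclidean_loss_ge:
  assumes "attains_loss static_euclidean n f L" "1 \<le> n" "2 * 4 ^ i \<le> n"
  shows "i / 128 \<le> real L + 1"
proof (rule discrepancy_lower_bound[OF assms(2) _ assms(3)])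
  define w where "w j = f [0..<n] (replicate (Suc j) (line_ballots n))" for j
  fix k T :: nat assume k: "k < n"
  show "\<bar>discrepancy w n k T\<bar> \<le> real L + 1"
  proof (cases "T = 0")
    case True
    then show ?thesis by (simp add: discrepancy_def counting_def)
  next
    case False
    define P where "P = replicate T (line_ballots n)"
    have "all_rank_wPJR n n P (outcome f [0..<n] P) L"
      using assms(1) is_profile_line[of n T] static_euclidean_line[of n T] assms(2) False
      unfolding attains_loss_def P_def by (auto simp: is_voter_order_def lessThan_atLeast0)
    moreover have "outcome f [0..<n] P j = w j" if "j < T" for j
      using that by (simp add: outcome_def w_def P_def take_replicate min_def)
    ultimately have "all_rank_wPJR n n P w L"
      unfolding all_rank_wPJR_def P_def by (simp cong: conj_cong)
    then show ?thesis using k unfolding P_def by (rule all_rank_wPJR_line)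
  qed
qed

lemma static_euclidean_loss_ge_log:
  assumes "attains_loss static_euclidean n f L" "1 \<le> n"
  shows "(log 4 n - 2) / 128 \<le> real L + 1"
proof (cases "n < 2")
  case False
  \<comment> \<open>The largest \<open>i\<close> with \<open>2 * 4 ^ i \<le> n\<close>. The 2 in the
    claim pays 1 for the factor 2 under the logarithm and 1 for the floor.\<close>
  define i where "i = nat \<lfloor>log 4 (n / 2)\<rfloor>"
  have "0 \<le> log 4 (real n / 2)" using False by simp
  then have i: "real i \<le> log 4 (real n / 2)" "log 4 (real n / 2) < real i + 1"
    unfolding i_def by (simp_all add: of_nat_nat)
  have "4 powr real i \<le> 4 powr log 4 (real n / 2)" using i(1) by (intro powr_mono) auto
  then have "4 ^ i \<le> real n / 2" using False by (simp add: powr_realpow)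
  then have "real (2 * 4 ^ i) \<le> real n" by simp
  then have "2 * 4 ^ i \<le> n" by (simp only: of_nat_le_iff)
  then have "i / 128 \<le> real L + 1" using static_euclidean_loss_ge assms by blast
  moreover have "log 4 (real n) - 1 \<le> log 4 (real n / 2)"
    using False log_le_cancel_iff[of 4 2 4] by (simp add: log_divide)
  ultimately show ?thesis using i(2) by simp
next
  case True
  then have "n = 1" using assms(2) by simp
  then show ?thesis by simp
qed

section \<open>Monotonicity, optimal loss and asymptotics\<close>

lemma attains_loss_domain_mono:
  "attains_loss D n f L \<Longrightarrow> (\<And>m \<sigma> P. D' n m \<sigma> P \<Longrightarrow> D n m \<sigma> P) \<Longrightarrow> attains_loss D' n f L"
  unfolding attains_loss_def by blast

lemma all_rank_wPJR_mono:
  assumes "all_rank_wPJR n m P w L" "L \<le> L'"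
  shows "all_rank_wPJR n m P w L'"
  unfolding all_rank_wPJR_def
proof (intro allI impI)
  fix R S
  assume "(\<forall>j<length P. \<forall>i<n. R j i \<in> {1..m}) \<and> S \<noteq> {} \<and> S \<subseteq> {..<n} \<and>
    (\<forall>j<length P. (\<Inter>i\<in>S. top_set P j i (R j i)) \<noteq> {})"
  from assms(1)[unfolded all_rank_wPJR_def, rule_format, OF this] assms(2)
  show "\<lfloor>real (length P) * real (card S) / real n\<rfloor> - int L'
      \<le> int (card {j. j < length P \<and> w j \<in> (\<Union>i\<in>S. top_set P j i (R j i))})"
    by linarith
qed

lemma attains_loss_mono:
  "attains_loss D n f L \<Longrightarrow> L \<le> L' \<Longrightarrow> attains_loss D n f L'"
  unfolding attains_loss_def using all_rank_wPJR_mono by blast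

lemma single_crossing_attains_static_euclidean:
  "attains_loss single_crossing n f L \<Longrightarrow> attains_loss static_euclidean n f L"
  by (erule attains_loss_domain_mono) (simp add: static_euclidean_def)

text \<open>The loss \<open>nat \<lceil>log 2 (real n)\<rceil>\<close>, a depth sufficient for
  \<open>n\<close> leaves, is already attained; the factor 2 enters through
  \<open>attains_loss_mono\<close>.\<close>

lemma interleaved_rule_attains_log:
  assumes "1 \<le> n"
  shows "attains_loss single_crossing n interleaved_rule (2 * nat \<lceil>log 2 (real n)\<rceil>)"
proof (rule attains_loss_mono[OF interleaved_rule_attains[where d = "nat \<lceil>log 2 (real n)\<rceil>"]])
  have "real n = 2 powr log 2 n" using assms by simp
  also have "\<dots> \<le> 2 powr real (nat \<lceil>log 2 (real n)\<rceil>)" using assms by (intro powr_mono) linarith+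
  finally have "real n \<le> real (2 ^ nat \<lceil>log 2 (real n)\<rceil>)" by (simp add: powr_realpow)
  then show "n \<le> 2 ^ nat \<lceil>log 2 (real n)\<rceil>" by (simp only: of_nat_le_iff)
qed linarith

text \<open>\<open>LEAST\<close> denotes an attained loss only once some rule attains some loss;
  \<open>f\<close> supplies this.\<close>

lemma optimal_loss_attained:
  assumes "attains_loss D n f L" "online_rule f"
  shows "\<exists>g. online_rule g \<and> attains_loss D n g (optimal_loss D n)" "optimal_loss D n \<le> L"
proof -
  have *: "\<exists>g. online_rule g \<and> attains_loss D n g L" using assms by blast
  show "\<exists>g. online_rule g \<and> attains_loss D n g (optimal_loss D n)"
    unfolding optimal_loss_def by (rule LeastI[of "\<lambda>L. \<exists>g. online_rule g \<and> attains_loss D n g L", OF *])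
  show "optimal_loss D n \<le> L"
    unfolding optimal_loss_def by (rule Least_le[of "\<lambda>L. \<exists>g. online_rule g \<and> attains_loss D n g L", OF *])
qed

text \<open>The rule may vary with \<open>n\<close>, as it may in
  \<open>optimal_loss\<close>.\<close>

lemma loss_bigomega:
  fixes L :: "nat \<Rightarrow> nat"
  assumes "\<And>n. 1 \<le> n \<Longrightarrow> \<exists>f. attains_loss static_euclidean n f (L n)"
  shows "(\<lambda>n. real (L n)) \<in> \<Omega>(\<lambda>n. ln (real n))"
proof (rule landau_omega.big_trans)
  show "(\<lambda>n. (log 4 (real n) - 2) / 128 - 1) \<in> \<Omega>(\<lambda>n. ln (real n))"
    by real_asymp
  have "eventually (\<lambda>n. 0 \<le> (log 4 (real n) - 2) / 128 - 1) sequentially"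
    by real_asymp
  then have "eventually (\<lambda>n. norm (real (L n)) \<ge> 1 * norm ((log 4 (real n) - 2) / 128 - 1)) sequentially"
    using eventually_ge_at_top[of 1]
  proof eventually_elim
    case (elim n)
    then obtain f where "attains_loss static_euclidean n f (L n)" using assms by blast
    then have "(log 4 (real n) - 2) / 128 \<le> real (L n) + 1"
      using elim(2) by (rule static_euclidean_loss_ge_log)
    then show ?case using elim(1) by (simp add: field_simps)
  qed
  then show "(\<lambda>n. real (L n)) \<in> \<Omega>(\<lambda>n. (log 4 (real n) - 2) / 128 - 1)"
    by (rule landau_omega.bigI[rotated]) simp
qed

text \<open>Together with the lower bound, the assumption would make the logarithm little-o of
  itself, hence eventually zero.\<close>

lemma loss_not_smallo:
  fixes L :: "nat \<Rightarrow> nat"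
  assumes "(\<lambda>n. real (L n)) \<in> o(\<lambda>n. ln (real n))"
    "\<And>n. 1 \<le> n \<Longrightarrow> attains_loss static_euclidean n f (L n)"
  shows False
proof -
  have "(\<lambda>n. ln (real n)) \<in> O(\<lambda>n. real (L n))"
    using loss_bigomega[of L] assms(2) by (auto simp: bigomega_iff_bigo)
  then have "(\<lambda>n. ln (real n)) \<in> o(\<lambda>n. ln (real n))"
    using assms(1) by (rule landau_o.big_small_trans)
  then have "eventually (\<lambda>n. ln (real n) = 0) sequentially" by (simp add: landau_o.small_refl_iff)
  moreover have "eventually (\<lambda>n. ln (real n) \<noteq> 0) sequentially"
    using eventually_gt_at_top[of 1] by eventually_elim simp
  ultimately have "eventually (\<lambda>n::nat. False) sequentially" by eventually_elim simp
  then show False by simp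
qed

theorem theorem5p9:
  shows
    "(\<exists>f. online_rule f \<and> polytime_rule f \<and>
        (\<forall>n\<ge>1. attains_loss single_crossing n f (2 * nat \<lceil>log 2 (real n)\<rceil>)))
   \<and> (\<forall>L :: nat \<Rightarrow> nat. (\<lambda>n. real (L n)) \<in> o(\<lambda>n. ln (real n)) \<longrightarrow>
        \<not> (\<exists>f. online_rule f \<and> (\<forall>n\<ge>1. attains_loss single_crossing n f (L n))))
   \<and> (\<forall>L :: nat \<Rightarrow> nat. (\<lambda>n. real (L n)) \<in> o(\<lambda>n. ln (real n)) \<longrightarrow>
        \<not> (\<exists>f. online_rule f \<and> (\<forall>n\<ge>1. attains_loss static_euclidean n f (L n))))
   \<and> (\<lambda>n. real (optimal_loss static_euclidean n)) \<in> \<Omega>(\<lambda>n. ln (real n))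
   \<and> (\<lambda>n. real (optimal_loss single_crossing n)) \<in> \<Theta>(\<lambda>n. ln (real n))"
proof (intro conjI)
  note upper = interleaved_rule_attains_log online_interleaved_rule
  show "\<exists>f. online_rule f \<and> polytime_rule f \<and>
        (\<forall>n\<ge>1. attains_loss single_crossing n f (2 * nat \<lceil>log 2 (real n)\<rceil>))"
    using upper polytime_interleaved_rule by blast
  show "\<forall>L :: nat \<Rightarrow> nat. (\<lambda>n. real (L n)) \<in> o(\<lambda>n. ln (real n)) \<longrightarrow>
        \<not> (\<exists>f. online_rule f \<and> (\<forall>n\<ge>1. attains_loss static_euclidean n f (L n)))"
    using loss_not_smallo by blast
  then show "\<forall>L :: nat \<Rightarrow> nat. (\<lambda>n. real (L n)) \<in> o(\<lambda>n. ln (real n)) \<longrightarrow>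
        \<not> (\<exists>f. online_rule f \<and> (\<forall>n\<ge>1. attains_loss single_crossing n f (L n)))"
    using single_crossing_attains_static_euclidean by blast
  show "(\<lambda>n. real (optimal_loss static_euclidean n)) \<in> \<Omega>(\<lambda>n. ln (real n))"
    by (intro loss_bigomega)
      (use optimal_loss_attained(1)[OF single_crossing_attains_static_euclidean] upper in blast)
  have "(\<lambda>n. real (optimal_loss single_crossing n)) \<in> \<Omega>(\<lambda>n. ln (real n))"
    by (intro loss_bigomega)
      (use optimal_loss_attained(1) single_crossing_attains_static_euclidean upper in blast)
  moreover have "(\<lambda>n. real (optimal_loss single_crossing n)) \<in> O(\<lambda>n. ln (real n))"
  proof (rule landau_o.big_trans)
    show "(\<lambda>n. 2 * (log 2 (real n) + 1)) \<in> O(\<lambda>n. ln (real n))" by real_asymp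
    have "real (optimal_loss single_crossing n) \<le> 2 * (log 2 (real n) + 1)" if "1 \<le> n" for n
    proof -
      \<comment> \<open>Ensures that \<open>nat\<close> does not truncate the ceiling.\<close>
      have "0 \<le> log 2 (real n)" using that by simp
      then have "real (nat \<lceil>log 2 (real n)\<rceil>) = real_of_int \<lceil>log 2 (real n)\<rceil>" by simp
      then have "real (2 * nat \<lceil>log 2 (real n)\<rceil>) \<le> 2 * (log 2 (real n) + 1)"
        using ceiling_correct[of "log 2 (real n)"] by simp
      moreover have "optimal_loss single_crossing n \<le> 2 * nat \<lceil>log 2 (real n)\<rceil>"
        using upper that by (intro optimal_loss_attained(2))
      ultimately show ?thesis by linarith
    qed
    then show "(\<lambda>n. real (optimal_loss single_crossing n)) \<in> O(\<lambda>n. 2 * (log 2 (real n) + 1))"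
      by (intro landau_o.bigI[of 1] eventually_sequentiallyI[of 1]) fastforce+
  qed
  ultimately show "(\<lambda>n. real (optimal_loss single_crossing n)) \<in> \<Theta>(\<lambda>n. ln (real n))"
    by (simp add: bigtheta_def)
qed

end
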